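(* Let $N\ge 3$ and $1\le r\le N$, and write $N=qr+s$ with integers $q,s$ and $0\le s<r$. Consider all sets $R$ consisting of $r$ rim vertices of the wheel graph $W_{N+1}$, and let $d_1,\ldots,d_r$ denote the cyclic intervals of $R$. (1) Among all such $R$, the number $\mathcal F_{W_{N+1}}(R)$ is maximized if and only if, in the cyclic interval sequence $(d_1,\ldots,d_r)$, the value $q+1$ appears $s$ times and the value $q$ appears $r-s$ times. The maximum value is $$F_{2(q+1)}^{\,s}F_{2q}^{\,r-s}\left(s\,\frac{L_{2(q+1)}-2}{F_{2(q+1)}}+(r-s)\,\frac{L_{2q}-2}{F_{2q}}\right).$$ (2) Among all such $R$, the number $\mathcal F_{W_{N+1}}(R)$ is minimized if and only if, in $(d_1,\ldots,d_r)$, one cyclic interval is $N-r+1$ and the remaining $r-1$ cyclic intervals are all equal to $1$. The minimum value is $$L_{2(N-r+1)}-2+(r-1)F_{2(N-r+1)}.$$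
   Context: The wheel graph $W_{N+1}$ ($N\ge3$) has vertex set $\{c,v_1,\ldots,v_N\}$ and edges $\{v_i,v_{i+1}\}$ (indices modulo $N$) and $\{c,v_i\}$ for $1\le i\le N$; $c$ is the central vertex and the $v_i$ are the rim vertices. For a set $R=\{v_{a_1},\ldots,v_{a_r}\}$ of rim vertices with $1\le a_1<\cdots<a_r\le N$, the cyclic intervals are $d_i=a_{i+1}-a_i$ for $1\le i\le r-1$ and $d_r=a_1+N-a_r$. For a finite connected graph $G$ and $\varnothing\ne R\subseteq V(G)$, a rooted spanning forest of $G$ with root set $R$ is a spanning forest (an acyclic subgraph containing all vertices of $G$) in which each connected component contains exactly one vertex of $R$; $\mathcal F_G(R)$ denotes the number of such forests. Fibonacci numbers: $F_0=0$, $F_1=1$, $F_{n+2}=F_{n+1}+F_n$. Lucas numbers: $L_0=2$, $L_1=1$, $L_{n+2}=L_{n+1}+L_n$. *)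

theory Defs
  imports Complex_Main "HOL-Number_Theory.Fib"
begin

section \<open>Undirected graphs\<close>

text \<open>The edges of a simple graph are two-element sets of vertices.\<close>

record 'a ugraph =
  vertices :: "'a set"
  edges :: "'a set set"

definition simple_graph :: "'a ugraph \<Rightarrow> bool" where
  "simple_graph G \<longleftrightarrow> (\<forall>e\<in>edges G. e \<subseteq> vertices G \<and> card e = 2)"

definition subgraph :: "'a ugraph \<Rightarrow> 'a ugraph \<Rightarrow> bool" where
  "subgraph H G \<longleftrightarrow> simple_graph H \<and> vertices H \<subseteq> vertices G \<and> edges H \<subseteq> edges G"

definition adjacent :: "'a ugraph \<Rightarrow> 'a \<Rightarrow> 'a \<Rightarrow> bool" where
  "adjacent G u v \<longleftrightarrow> {u, v} \<in> edges G"

definition components :: "'a ugraph \<Rightarrow> 'a set set" where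
  "components G = (\<lambda>u. {v \<in> vertices G. (adjacent G)\<^sup>*\<^sup>* u v}) ` vertices G"

text \<open>A cycle is given by the list of its pairwise distinct vertices, the last of which is
  adjacent to the first.\<close>

definition is_cycle :: "'a ugraph \<Rightarrow> 'a list \<Rightarrow> bool" where
  "is_cycle G xs \<longleftrightarrow> length xs \<ge> 3 \<and> distinct xs \<and>
     (\<forall>i<length xs. adjacent G (xs ! i) (xs ! (Suc i mod length xs)))"

definition acyclic_graph :: "'a ugraph \<Rightarrow> bool" where
  "acyclic_graph G \<longleftrightarrow> (\<nexists>xs. is_cycle G xs)"


section \<open>Rooted spanning forests\<close>

definition spanning_forest :: "'a ugraph \<Rightarrow> 'a ugraph \<Rightarrow> bool" where
  "spanning_forest G H \<longleftrightarrow> subgraph H G \<and> vertices H = vertices G \<and> acyclic_graph H"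

definition rooted_spanning_forest :: "'a ugraph \<Rightarrow> 'a set \<Rightarrow> 'a ugraph \<Rightarrow> bool" where
  "rooted_spanning_forest G R H \<longleftrightarrow>
     spanning_forest G H \<and> (\<forall>C\<in>components H. \<exists>!v. v \<in> C \<and> v \<in> R)"

definition num_rooted_forests :: "'a ugraph \<Rightarrow> 'a set \<Rightarrow> nat" where
  "num_rooted_forests G R = card {H. rooted_spanning_forest G R H}"


section \<open>Wheel graphs\<close>

datatype wheel_vertex = Center | Rim nat

definition rim :: "nat \<Rightarrow> wheel_vertex set" where
  "rim N = Rim ` {1..N}"

text \<open>\<open>wheel N\<close> is the wheel with \<open>N\<close> rim vertices, that is, $W_{N+1}$. The successor of the
  rim index \<open>i\<close>, with representatives modulo \<open>N\<close> taken in \<open>{1..N}\<close>, is \<open>i mod N + 1\<close>.\<close>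

definition wheel :: "nat \<Rightarrow> wheel_vertex ugraph" where
  "wheel N = \<lparr>vertices = insert Center (rim N),
              edges = (\<lambda>i. {Rim i, Rim (i mod N + 1)}) ` {1..N} \<union>
                      (\<lambda>i. {Center, Rim i}) ` {1..N}\<rparr>"

text \<open>Here and below lists are indexed from 0, so \<open>a ! i\<close> is $a_{i+1}$. The natural-number
  subtractions do not truncate when \<open>R \<subseteq> rim N\<close>.\<close>

definition cyclic_intervals :: "nat \<Rightarrow> wheel_vertex set \<Rightarrow> nat list" where
  "cyclic_intervals N R =
     (let a = sorted_list_of_set {i. Rim i \<in> R}; r = length a
      in map (\<lambda>i. if Suc i < r then a ! Suc i - a ! i else a ! 0 + N - a ! i) [0..<r])"

definition rim_root_sets :: "nat \<Rightarrow> nat \<Rightarrow> wheel_vertex set set" where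
  "rim_root_sets N r = {R. R \<subseteq> rim N \<and> card R = r}"


section \<open>Lucas numbers\<close>

fun lucas :: "nat \<Rightarrow> nat" where
  "lucas 0 = 2"
| "lucas (Suc 0) = 1"
| "lucas (Suc (Suc n)) = lucas (Suc n) + lucas n"

end

theory Submission
  imports Defs "HOL-Library.FuncSet" "HOL-Library.Multiset"
begin

text \<open>A rooted forest is the same thing as a choice, for every non-root, of a parent adjacent to it,
  such that some height strictly decreases from each vertex to its parent. On the wheel with rim
  roots, each rim non-root points down, up or to the hub, and the hub points to a rim vertex \<open>k\<close>;
  such a choice has a decreasing height iff no two rim neighbours point at each other and the path
  from \<open>k\<close> runs along the rim into a root. The words on an arc of length \<open>d\<close> without
  up-down factor are counted by $F_{2d}$, and summing over \<open>k\<close> within that arc gives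
  $L_{2d}-2$, so that the number of forests is $\prod_i F_{2d_i} \sum_i (L_{2d_i}-2)/F_{2d_i}$.
  Replacing two intervals $x \ge y+2$ by $x-1$ and $y+1$ strictly increases this value, since it
  does not decrease $F_{2x}F_{2y}$ and strictly increases
  $(L_{2x}-2)F_{2y}+F_{2x}(L_{2y}-2) = 2(F_{2(x+y)}-F_{2x}-F_{2y})$. Hence the maximum is
  attained exactly at balanced intervals and the minimum exactly when at most one of them
  exceeds 1.\<close>

section \<open>Rooted forests as parent functions\<close>

text \<open>Extensionality on the non-roots makes each choice of parents a single function, so that
  choices can be counted. The decreasing height \<open>h\<close> excludes closed parent
  orbits.\<close>

definition parent_functions :: "'a ugraph \<Rightarrow> 'a set \<Rightarrow> ('a \<Rightarrow> 'a) set" where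
  "parent_functions G R =
     {p \<in> (vertices G - R) \<rightarrow>\<^sub>E vertices G.
        (\<forall>v\<in>vertices G - R. {v, p v} \<in> edges G) \<and>
        (\<exists>h :: 'a \<Rightarrow> nat. \<forall>v\<in>vertices G - R. h (p v) < h v)}"

definition parent_graph :: "'a ugraph \<Rightarrow> 'a set \<Rightarrow> ('a \<Rightarrow> 'a) \<Rightarrow> 'a ugraph" where
  "parent_graph G R p = \<lparr>vertices = vertices G, edges = (\<lambda>v. {v, p v}) ` (vertices G - R)\<rparr>"

lemma vertices_parent_graph [simp]: "vertices (parent_graph G R p) = vertices G"
  by (simp add: parent_graph_def)

lemma adjacent_sym: "adjacent G u v \<longleftrightarrow> adjacent G v u"
  by (simp add: adjacent_def insert_commute)

lemma rtranclp_adjacent_sym: "(adjacent G)\<^sup>*\<^sup>* u v \<Longrightarrow> (adjacent G)\<^sup>*\<^sup>* v u"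
  by (metis adjacent_sym sympI sympD symp_rtranclp)

lemma adjacent_parent_graph:
  "adjacent (parent_graph G R p) u v \<longleftrightarrow>
     (u \<in> vertices G - R \<and> v = p u) \<or> (v \<in> vertices G - R \<and> u = p v)"
  by (auto simp: adjacent_def parent_graph_def doubleton_eq_iff)

text \<open>If a newly prepended vertex already lies on the path, the path is cut back to the suffix
  that starts there, so vertices stay distinct.\<close>

lemma rtranclp_distinct_path:
  assumes "r\<^sup>*\<^sup>* x y"
  shows "\<exists>xs. xs \<noteq> [] \<and> hd xs = x \<and> last xs = y \<and> distinct xs \<and> successively r xs"
  using assms
proof (induction rule: converse_rtranclp_induct)
  case base
  show ?case by (rule exI[of _ "[y]"]) auto
next
  case (step x z)
  then obtain xs where xs: "xs \<noteq> []" "hd xs = z" "last xs = y" "distinct xs" "successively r xs"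
    by blast
  show ?case
  proof (cases "x \<in> set xs")
    case True
    then obtain as bs where "xs = as @ x # bs" by (meson split_list)
    with xs show ?thesis
      by (intro exI[of _ "x # bs"]) (auto simp: successively_append_iff)
  next
    case False
    with xs step show ?thesis
      by (intro exI[of _ "x # xs"]) (cases xs; auto)
  qed
qed

text \<open>A simple path from \<open>x\<close> to \<open>y\<close> in \<open>K\<close> is closed by
  the edge of \<open>H\<close>. Since that edge is not in \<open>K\<close>, the path has an
  intermediate vertex, which gives the three vertices a cycle requires.\<close>

lemma cycle_from_connected_edge:
  assumes "adjacent H x y" "x \<noteq> y" "(adjacent K)\<^sup>*\<^sup>* x y" "edges K \<subseteq> edges H" "\<not> adjacent K x y"
  shows "\<exists>xs. is_cycle H xs"
proof -
  obtain xs where xs: "xs \<noteq> []" "hd xs = x" "last xs = y" "distinct xs" "successively (adjacent K) xs"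
    using rtranclp_distinct_path[OF assms(3)] by blast
  have len: "length xs \<ge> 3"
  proof (rule ccontr)
    assume "\<not> length xs \<ge> 3"
    moreover have "length xs \<noteq> 0" using xs(1) by simp
    ultimately have "length xs = 1 \<or> length xs = 2" by linarith
    then show False
      using xs assms(2,5) by (auto simp: length_Suc_conv numeral_2_eq_2)
  qed
  have "adjacent H (xs ! i) (xs ! (Suc i mod length xs))" if i: "i < length xs" for i
  proof (cases "Suc i = length xs")
    case True
    then show ?thesis
      using xs(1-3) assms(1) adjacent_sym[of H]
      by (metis diff_Suc_1 hd_conv_nth last_conv_nth mod_self)
  next
    case False
    then have "adjacent K (xs ! i) (xs ! Suc i)"
      using xs(5) i by (simp add: successively_conv_nth)
    then show ?thesis using False i assms(4) by (auto simp: adjacent_def)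
  qed
  then show ?thesis using len xs(4) by (auto simp: is_cycle_def)
qed

section \<open>Parent functions yield rooted spanning forests\<close>

lemma parent_function_reaches_root:
  assumes p: "p \<in> parent_functions G R" and v: "v \<in> vertices G"
  shows "\<exists>x\<in>R \<inter> vertices G. (adjacent (parent_graph G R p))\<^sup>*\<^sup>* v x"
proof -
  obtain h :: "_ \<Rightarrow> nat" where h: "\<forall>v\<in>vertices G - R. h (p v) < h v"
    using p by (auto simp: parent_functions_def)
  show ?thesis using v
  proof (induction "h v" arbitrary: v rule: less_induct)
    case less
    show ?case
    proof (cases "v \<in> R")
      case False
      with less.prems p have "p v \<in> vertices G" by (auto simp: parent_functions_def)
      moreover have "h (p v) < h v" using h False less.prems by auto
      ultimately obtain x where "x \<in> R \<inter> vertices G" "(adjacent (parent_graph G R p))\<^sup>*\<^sup>* (p v) x"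
        using less.hyps by blast
      moreover have "adjacent (parent_graph G R p) v (p v)"
        using False less.prems by (simp add: adjacent_parent_graph)
      ultimately show ?thesis by (meson converse_rtranclp_into_rtranclp)
    qed (use less.prems in auto)
  qed
qed

text \<open>On a cycle take a vertex of maximal height. A neighbour having it as parent would be
  higher, so both its neighbours on the cycle are its own parent, although they are
  distinct.\<close>

lemma acyclic_parent_graph:
  assumes p: "p \<in> parent_functions G R"
  shows "acyclic_graph (parent_graph G R p)"
  unfolding acyclic_graph_def
proof
  assume "\<exists>xs. is_cycle (parent_graph G R p) xs"
  then obtain xs where len: "length xs \<ge> 3" and dist: "distinct xs"
    and adj: "\<And>i. i < length xs \<Longrightarrow> adjacent (parent_graph G R p) (xs ! i) (xs ! (Suc i mod length xs))"
    by (auto simp: is_cycle_def)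
  obtain h :: "_ \<Rightarrow> nat" where h: "\<forall>v\<in>vertices G - R. h (p v) < h v"
    using p by (auto simp: parent_functions_def)
  let ?n = "length xs"
  have fin: "finite ((\<lambda>i. h (xs ! i)) ` {..<?n})" and ne: "(\<lambda>i. h (xs ! i)) ` {..<?n} \<noteq> {}"
    using len by (auto simp: lessThan_empty_iff)
  obtain i where i: "i < ?n" and "h (xs ! i) = Max ((\<lambda>i. h (xs ! i)) ` {..<?n})"
    using Max_in[OF fin ne] by auto
  then have mx: "h (xs ! j) \<le> h (xs ! i)" if "j < ?n" for j
    using fin that by simp
  have nb: "xs ! j = p (xs ! i)"
    if "j < ?n" "adjacent (parent_graph G R p) (xs ! i) (xs ! j)" for j
    using that(2) h mx[OF that(1)] unfolding adjacent_parent_graph by (metis not_le)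
  define j where "j = Suc i mod ?n"
  define k where "k = (if i = 0 then ?n - 1 else i - 1)"
  have jk: "j < ?n" "k < ?n" "j \<noteq> k" "Suc k mod ?n = i"
    using i len unfolding j_def k_def by (auto simp: mod_Suc)
  have "xs ! j = p (xs ! i)" using nb adj[OF i] jk(1) by (simp add: j_def)
  moreover have "xs ! k = p (xs ! i)"
    using nb[OF jk(2)] adj[OF jk(2)] jk(4) adjacent_sym by metis
  ultimately show False using nth_eq_iff_index_eq[OF dist jk(1,2)] jk(3) by simp
qed

text \<open>Parent steps are deterministic, so the parent chains of two connected vertices meet. A
  root admits no parent step; hence the chain of \<open>u\<close> runs into both \<open>x\<close>
  and \<open>y\<close> and stops at each of them.\<close>

lemma parent_graph_root_unique:
  assumes "(adjacent (parent_graph G R p))\<^sup>*\<^sup>* u x" "(adjacent (parent_graph G R p))\<^sup>*\<^sup>* u y" "x \<in> R" "y \<in> R"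
  shows "x = y"
proof -
  define E where "E v w \<longleftrightarrow> v \<in> vertices G - R \<and> w = p v" for v w
  have join: "\<exists>z. E\<^sup>*\<^sup>* u z \<and> E\<^sup>*\<^sup>* v z" if "(adjacent (parent_graph G R p))\<^sup>*\<^sup>* u v" for v
    using that
  proof (induction rule: rtranclp_induct)
    case base
    then show ?case by blast
  next
    case (step v w)
    then obtain z where z: "E\<^sup>*\<^sup>* u z" "E\<^sup>*\<^sup>* v z" by blast
    from step(2) consider "E v w" | "E w v" by (auto simp: adjacent_parent_graph E_def)
    then show ?case
    proof cases
      case 1
      show ?thesis
      proof (cases "v = z")
        case True
        with 1 z(1) show ?thesis by (blast intro: rtranclp.rtrancl_into_rtrancl)
      next
        case False
        from z(2) have "E\<^sup>*\<^sup>* w z"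
          by (cases rule: converse_rtranclpE) (use 1 False in \<open>auto simp: E_def\<close>)
        with z(1) show ?thesis by blast
      qed
    next
      case 2
      with z show ?thesis by (meson converse_rtranclp_into_rtranclp)
    qed
  qed
  have stuck: "z = v" if "v \<in> R" "E\<^sup>*\<^sup>* v z" for v z
    using that(2,1) by (cases rule: converse_rtranclpE) (auto simp: E_def)
  have ux: "E\<^sup>*\<^sup>* u x" using join[OF assms(1)] stuck[OF assms(3)] by blast
  have uy: "E\<^sup>*\<^sup>* u y" using join[OF assms(2)] stuck[OF assms(4)] by blast
  from ux uy show ?thesis
  proof (induction rule: converse_rtranclp_induct)
    case base
    then show ?case using stuck[OF assms(3)] by blast
  next
    case (step v w)
    from step(4) show ?case
    proof (cases rule: converse_rtranclpE)
      case base
      then show ?thesis using step(1) assms(4) by (simp add: E_def)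
    next
      case (step w')
      then show ?thesis using step.IH \<open>E v w\<close> by (auto simp: E_def)
    qed
  qed
qed

lemma rooted_spanning_forest_parent_graph:
  assumes G: "simple_graph G" and p: "p \<in> parent_functions G R"
  shows "rooted_spanning_forest G R (parent_graph G R p)"
proof -
  have "edges (parent_graph G R p) \<subseteq> edges G"
    using p by (auto simp: parent_functions_def parent_graph_def)
  then have "spanning_forest G (parent_graph G R p)"
    using G acyclic_parent_graph[OF p]
    using p unfolding spanning_forest_def subgraph_def simple_graph_def
    by (auto simp: parent_graph_def parent_functions_def)
  moreover have "\<exists>!v. v \<in> C \<and> v \<in> R" if C: "C \<in> components (parent_graph G R p)" for C
  proof -
    obtain u where u: "u \<in> vertices G"
      "C = {v \<in> vertices G. (adjacent (parent_graph G R p))\<^sup>*\<^sup>* u v}"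
      using C by (auto simp: components_def)
    with parent_function_reaches_root[OF p u(1)] parent_graph_root_unique[of G R p u]
    show ?thesis by blast
  qed
  ultimately show ?thesis by (simp add: rooted_spanning_forest_def)
qed

section \<open>The correspondence is bijective\<close>

text \<open>Induction on the height: the edge from \<open>v\<close> to \<open>p v\<close> belongs to
  the graph of \<open>q\<close>, so \<open>q v = p v\<close> or \<open>q (p v) = v\<close>. In the
  second case the induction hypothesis at the lower vertex \<open>p v\<close> gives
  \<open>p (p v) = v\<close>, which contradicts the decrease of heights.\<close>

lemma inj_on_parent_graph: "inj_on (parent_graph G R) (parent_functions G R)"
proof (rule inj_onI)
  fix p q
  assume p: "p \<in> parent_functions G R" and q: "q \<in> parent_functions G R"
    and eq: "parent_graph G R p = parent_graph G R q"
  obtain h :: "_ \<Rightarrow> nat" where h: "\<forall>v\<in>vertices G - R. h (p v) < h v"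
    using p by (auto simp: parent_functions_def)
  have "p v = q v" if "v \<in> vertices G - R" for v
    using that
  proof (induction "h v" arbitrary: v rule: less_induct)
    case less
    have "adjacent (parent_graph G R q) v (p v)"
      using less.prems eq by (metis adjacent_parent_graph)
    then consider "p v = q v" | "p v \<in> vertices G - R" "v = q (p v)"
      by (auto simp: adjacent_parent_graph)
    then show ?case
    proof cases
      case 2
      have lt: "h (p v) < h v" using h less.prems by auto
      then have "p (p v) = v" using less.hyps 2 by simp
      then show ?thesis using h 2 lt by (metis order_less_asym)
    qed
  qed
  then show "p = q"
    using p q by (intro PiE_ext) (auto simp: parent_functions_def)
qed

text \<open>Every non-root takes as parent a neighbour closer to the root set. The resulting graph
  lies inside \<open>H\<close>, and acyclicity of \<open>H\<close> leaves no further edge.\<close>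

lemma rooted_spanning_forest_obtain_parent:
  assumes H: "rooted_spanning_forest G R H"
  shows "H \<in> parent_graph G R ` parent_functions G R"
proof -
  have vH: "vertices H = vertices G" and sH: "simple_graph H" and eH: "edges H \<subseteq> edges G"
    and acyc: "\<nexists>xs. is_cycle H xs"
    and comp: "\<And>C. C \<in> components H \<Longrightarrow> \<exists>!v. v \<in> C \<and> v \<in> R"
    using H by (auto simp: rooted_spanning_forest_def spanning_forest_def subgraph_def acyclic_graph_def)
  have adjV: "u \<in> vertices G" "v \<in> vertices G" "u \<noteq> v" if "adjacent H u v" for u v
    using that sH vH by (auto simp: adjacent_def simple_graph_def dest!: bspec)
  have root: "\<exists>!x. x \<in> R \<inter> vertices G \<and> (adjacent H)\<^sup>*\<^sup>* v x" if "v \<in> vertices G" for v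
  proof -
    have "{w \<in> vertices H. (adjacent H)\<^sup>*\<^sup>* v w} \<in> components H"
      using that vH by (auto simp: components_def)
    from comp[OF this] vH show ?thesis by auto
  qed
  \<comment> \<open>\<open>d v\<close> is the distance in \<open>H\<close> from \<open>v\<close> to
    the nearest root; it serves as the height.\<close>
  define d where "d v = (LEAST n. \<exists>x\<in>R. (adjacent H ^^ n) v x)" for v
  have step: "\<exists>w. adjacent H v w \<and> d w < d v" if v: "v \<in> vertices G - R" for v
  proof -
    have "\<exists>n. \<exists>x\<in>R. (adjacent H ^^ n) v x"
      using root[of v] v by (metis DiffD1 IntD1 rtranclp_imp_relpowp)
    then have "\<exists>x\<in>R. (adjacent H ^^ d v) v x"
      unfolding d_def by (rule LeastI_ex)
    then obtain x where x: "x \<in> R" "(adjacent H ^^ d v) v x" by blast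
    then obtain m where m: "d v = Suc m" using v by (cases "d v") auto
    then obtain w where w: "adjacent H v w" "(adjacent H ^^ m) w x"
      using x by (metis relpowp_Suc_D2)
    then have "d w \<le> m" unfolding d_def using x by (blast intro: Least_le)
    with m w show ?thesis by auto
  qed
  then obtain p0 where p0: "\<And>v. v \<in> vertices G - R \<Longrightarrow> adjacent H v (p0 v) \<and> d (p0 v) < d v"
    by metis
  define p where "p = restrict p0 (vertices G - R)"
  have p: "p \<in> parent_functions G R"
    unfolding parent_functions_def
  proof (intro CollectI conjI)
    show "p \<in> (vertices G - R) \<rightarrow>\<^sub>E vertices G"
      unfolding p_def using p0 adjV(2) by (intro restrict_PiE_iff[THEN iffD2]) blast
    show "\<forall>v\<in>vertices G - R. {v, p v} \<in> edges G"
      unfolding p_def using p0 eH by (auto simp: adjacent_def)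
    show "\<exists>h :: 'a \<Rightarrow> nat. \<forall>v\<in>vertices G - R. h (p v) < h v"
      by (rule exI[of _ d]) (use p0 in \<open>auto simp: p_def\<close>)
  qed
  let ?K = "parent_graph G R p"
  have sub: "edges ?K \<subseteq> edges H"
    using p0 by (auto simp: parent_graph_def p_def adjacent_def)
  have mono: "(adjacent H)\<^sup>*\<^sup>* u v" if "(adjacent ?K)\<^sup>*\<^sup>* u v" for u v
    using that by (rule rtranclp_mono[THEN predicate2D, rotated]) (use sub in \<open>auto simp: adjacent_def\<close>)
  have "edges H \<subseteq> edges ?K"
  proof
    fix e assume e: "e \<in> edges H"
    then obtain x y where xy: "e = {x, y}"
      using sH by (auto simp: simple_graph_def card_2_iff)
    with e have a: "adjacent H x y" by (simp add: adjacent_def)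
    \<comment> \<open>Both ends of the edge are joined in \<open>?K\<close> to roots, and these
      roots agree because the component in \<open>H\<close> has only one. An edge outside
      \<open>?K\<close> would therefore close a cycle in \<open>H\<close>.\<close>
    have "(adjacent ?K)\<^sup>*\<^sup>* x y"
    proof -
      obtain u where u: "u \<in> R \<inter> vertices G" "(adjacent ?K)\<^sup>*\<^sup>* x u"
        using parent_function_reaches_root[OF p adjV(1)[OF a]] by blast
      obtain v where v: "v \<in> R \<inter> vertices G" "(adjacent ?K)\<^sup>*\<^sup>* y v"
        using parent_function_reaches_root[OF p adjV(2)[OF a]] by blast
      have "(adjacent H)\<^sup>*\<^sup>* x v"
        using a mono[OF v(2)] by (meson converse_rtranclp_into_rtranclp)
      then have "u = v" using root[OF adjV(1)[OF a]] u v mono by blast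
      with u v show ?thesis using rtranclp_adjacent_sym by (metis rtranclp_trans)
    qed
    then have "adjacent ?K x y"
      using cycle_from_connected_edge[OF a adjV(3)[OF a] _ sub] acyc by blast
    then show "e \<in> edges ?K" using xy by (simp add: adjacent_def)
  qed
  with sub vH have "H = ?K" by (cases H) (auto simp: parent_graph_def)
  with p show ?thesis by blast
qed

theorem num_rooted_forests_eq_card_parent_functions:
  assumes "simple_graph G"
  shows "num_rooted_forests G R = card (parent_functions G R)"
proof -
  have "{H. rooted_spanning_forest G R H} = parent_graph G R ` parent_functions G R"
    using rooted_spanning_forest_parent_graph[OF assms] rooted_spanning_forest_obtain_parent by blast
  then show ?thesis
    by (simp add: num_rooted_forests_def card_image inj_on_parent_graph)
qed

section \<open>The exchange inequality\<close>

text \<open>This eliminates Lucas numbers in favour of Fibonacci numbers; the additive form avoids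
  truncated subtraction.\<close>

lemma lucas_fib: "lucas n + fib n = 2 * fib (Suc n)"
  by (induction n rule: lucas.induct) auto

lemma real_lucas: "real (lucas n) = 2 * real (fib (Suc n)) - real (fib n)"
  using lucas_fib[of n] by (metis add_diff_cancel_right' of_nat_add of_nat_mult of_nat_numeral)

text \<open>The mixed terms contributed by two intervals collapse to a number that depends on the
  sum of their lengths only.\<close>

lemma fib_lucas_add:
  "real (lucas m) * real (fib n) + real (fib m) * real (lucas n) = 2 * real (fib (m + n))"
proof (cases m)
  case 0
  then show ?thesis by simp
next
  case (Suc k)
  have "fib (m + n) = fib (Suc n) * fib (Suc k) + fib n * fib k"
    using fib_add[of k n] Suc by (simp add: add.commute)
  moreover have "fib (Suc m) = fib m + fib k" using Suc by simp
  ultimately show ?thesis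
    using Suc by (simp add: real_lucas algebra_simps)
qed

text \<open>The counts of words on intervals will be identified through this three-term
  recurrence.\<close>

lemma fib_even_rec: "fib (2 * Suc (Suc n)) + fib (2 * n) = 3 * fib (2 * Suc n)"
  by (simp add: numeral_eq_Suc)

text \<open>The difference of the two products does not change with \<open>y\<close>, as the
  recurrence for even indices has determinant 1; at \<open>y = 0\<close> it is F_{2(e+1)}. With x =
  y + e + 2 it is the gain in F_{2x} F_{2y} under the exchange.\<close>

lemma fib_even_exchange:
  "fib (2 * Suc (y + e)) * fib (2 * Suc y) = fib (2 * Suc (Suc (y + e))) * fib (2 * y) + fib (2 * Suc e)"
proof (induction y)
  case 0
  then show ?case by simp
next
  case (Suc y)
  have 1: "real (fib (2 * Suc (Suc n))) = 3 * real (fib (2 * Suc n)) - real (fib (2 * n))" for n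
    using fib_even_rec[of n] by linarith
  from arg_cong[OF Suc, of real] have "real (fib (2 * Suc (Suc y + e))) * real (fib (2 * Suc (Suc y)))
     = real (fib (2 * Suc (Suc (Suc y + e)))) * real (fib (2 * Suc y)) + real (fib (2 * Suc e))"
    using 1[of y] 1[of "y + e"] 1[of "Suc (y + e)"] by (simp add: algebra_simps)
  then show ?case
    unfolding of_nat_mult[symmetric] of_nat_add[symmetric] of_nat_eq_iff .
qed

section \<open>The forest weight and the exchange step\<close>

text \<open>For positive parts this is the sum, over the parts, of L_{2d} - 2 times the product of
  the Fibonacci factors of all other parts, which is the form in which forests get counted.\<close>

definition forest_weight :: "nat multiset \<Rightarrow> real" where
  "forest_weight M = (\<Prod>d\<in>#M. real (fib (2 * d))) *
     (\<Sum>d\<in>#M. (real (lucas (2 * d)) - 2) / real (fib (2 * d)))"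

text \<open>It keeps the numerators of \<open>forest_weight\<close> positive and the natural-number
  subtraction L_{2d} - 2 exact.\<close>

lemma lucas_even_ge: "d > 0 \<Longrightarrow> lucas (2 * d) > 2"
proof -
  assume "d > 0"
  have "fib (2 * d - 1) + fib (2*d) = fib (Suc (2 * d))" using \<open>d > 0\<close> by (cases d) auto
  moreover have "fib (2 * d) \<ge> 1" "fib (2 * d - 1) \<ge> 1"
    using \<open>d > 0\<close> fib_neq_0_nat[of "2 * d"] fib_neq_0_nat[of "2 * d - 1"] by linarith+
  ultimately show ?thesis using lucas_fib[of "2 * d"] by linarith
qed

text \<open>Splitting off two parts isolates what an exchange changes: as \<open>x + y\<close> is
  preserved, only the product and the sum of F_{2x} and F_{2y} matter.\<close>

lemma forest_weight_pair:
  assumes "x > 0" "y > 0"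
  shows "forest_weight (add_mset x (add_mset y M)) =
    real (fib (2 * x)) * real (fib (2 * y)) * forest_weight M +
    2 * (real (fib (2 * (x + y))) - real (fib (2 * x)) - real (fib (2 * y))) * (\<Prod>d\<in>#M. real (fib (2 * d)))"
proof -
  have "fib (2 * x) \<noteq> 0" "fib (2 * y) \<noteq> 0" using assms by (simp_all add: fib_neq_0_nat)
  then show ?thesis
    using fib_lucas_add[of "2 * x" "2 * y"]
    by (simp add: forest_weight_def field_simps) algebra
qed

lemma forest_weight_exchange:
  assumes "0 \<notin># M" "y + 1 < x" "0 < y"
  shows "forest_weight (add_mset x (add_mset y M)) < forest_weight (add_mset (x - 1) (add_mset (y + 1) M))"
proof -
  obtain e where x: "x = y + 2 + e" using assms(2) less_iff_Suc_add by (auto simp: less_iff_Suc_add)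
  have P: "(\<Prod>d\<in>#M. real (fib (2 * d))) > 0"
    using assms(1) by (induction M) (auto simp: fib_neq_0_nat)
  have "(\<Sum>d\<in>#M. (real (lucas (2 * d)) - 2) / real (fib (2 * d))) \<ge> 0"
    using assms(1) by (induction M) (auto intro!: add_nonneg_nonneg simp: lucas_even_ge less_imp_le dest!: lucas_even_ge)
  with P have W: "forest_weight M \<ge> 0" by (simp add: forest_weight_def)
  \<comment> \<open>A weak inequality suffices here. Strictness must come from the other summand,
    because \<open>forest_weight M\<close> vanishes for empty \<open>M\<close> while the product
    \<open>P\<close> is always positive.\<close>
  have "fib (2 * x) * fib (2 * y) \<le> fib (2 * (x - 1)) * fib (2 * (y + 1))"
    using fib_even_exchange[of y e] x by (simp add: add.commute add.left_commute)
  then have 1: "real (fib (2 * x)) * real (fib (2 * y)) \<le> real (fib (2 * (x - 1))) * real (fib (2 * (y + 1)))"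
    by (metis of_nat_le_iff of_nat_mult)
  \<comment> \<open>The sum of the two Fibonacci numbers drops by F_{2x-1} and rises by F_{2y+1},
    and the drop is larger.\<close>
  have "fib (2 * x) = fib (2 * (x - 1)) + fib (2 * x - 1)" using x by (simp add: numeral_eq_Suc)
  moreover have "fib (2 * (y + 1)) = fib (2 * y) + fib (2 * y + 1)" by simp
  moreover have "fib (2 * y + 1) < fib (2 * x - 1)"
  proof -
    have "fib (2 * y + 3) \<le> fib (2 * x - 1)" using x by (intro fib_mono) auto
    moreover have "fib (2 * y + 1) < fib (2 * y + 3)"
      by (simp add: numeral_eq_Suc fib_neq_0_nat)
    ultimately show ?thesis by simp
  qed
  ultimately have 2: "real (fib (2 * (x - 1))) + real (fib (2 * (y + 1))) < real (fib (2 * x)) + real (fib (2 * y))"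
    by linarith
  have 3: "x - 1 + (y + 1) = x + y" using x by simp
  have "x > 0" "x - 1 > 0" using x by auto
  then show ?thesis
    using assms(3) mult_right_mono[OF 1 W] mult_strict_right_mono[OF 2 P]
    by (simp add: forest_weight_pair 3 del: fib.simps) (simp add: algebra_simps)
qed

section \<open>Extremal partitions\<close>

definition positive_partitions :: "nat \<Rightarrow> nat \<Rightarrow> nat multiset set" where
  "positive_partitions N r = {M. size M = r \<and> 0 \<notin># M \<and> sum_mset M = N}"

text \<open>Exchanging the least part \<open>m\<close> with a part above \<open>m + 1\<close> would
  increase the weight, so only \<open>m\<close> and \<open>m + 1\<close> occur; division with
  remainder then identifies them.\<close>

lemma forest_weight_max_balanced:
  assumes M: "M \<in> positive_partitions N r"
    and max: "\<And>M'. M' \<in> positive_partitions N r \<Longrightarrow> forest_weight M' \<le> forest_weight M"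
    and N: "N = q * r + s" "s < r"
  shows "M = replicate_mset s (q + 1) + replicate_mset (r - s) q"
proof -
  have M': "size M = r" "0 \<notin># M" "sum_mset M = N" using M by (auto simp: positive_partitions_def)
  have ne: "set_mset M \<noteq> {}" using M'(1) N(2) by auto
  define m where "m = Min (set_mset M)"
  have le: "m \<le> x" if "x \<in># M" for x
    using ne that by (auto simp: m_def)
  have mM: "m \<in># M" unfolding m_def using ne by (intro Min_in) auto
  have up: "x \<le> m + 1" if x: "x \<in># M" for x
  proof (rule ccontr)
    assume "\<not> x \<le> m + 1"
    then have lt: "m + 1 < x" by simp
    then have "m \<in># M - {#x#}" using mM by (simp add: in_diff_count)
    then obtain K where K: "M = add_mset x (add_mset m K)"
      using x by (metis insert_DiffM)
    have m0: "m > 0" "0 \<notin># K" using M' K mM by (auto intro: ccontr)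
    have "add_mset (x - 1) (add_mset (m + 1) K) \<in> positive_partitions N r"
      using M' K lt by (auto simp: positive_partitions_def)
    then show False using max forest_weight_exchange[OF m0(2) lt m0(1)] K by fastforce
  qed
  define k where "k = count M (m + 1)"
  have eq: "M = replicate_mset k (m + 1) + replicate_mset (count M m) m"
  proof (rule multiset_eqI)
    fix x
    show "count M x = count (replicate_mset k (m + 1) + replicate_mset (count M m) m) x"
      using up[of x] le[of x]
      by (cases "x = m \<or> x = m + 1") (auto simp: k_def le_Suc_eq simp flip: not_in_iff)
  qed
  have sz: "r = k + count M m" using arg_cong[OF eq, of size] M' by simp
  have "N = k * (m + 1) + count M m * m"
    using arg_cong[OF eq, of sum_mset] M'(3) by simp
  then have "N = m * r + k" using sz by (simp add: algebra_simps)
  \<comment> \<open>Since \<open>m\<close> itself occurs, not all parts equal \<open>m + 1\<close>;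
    thus \<open>k\<close> is a genuine remainder.\<close>
  moreover have "k < r" using sz mM by simp
  ultimately have "N div r = m" "N mod r = k" by simp_all
  moreover have "N div r = q" "N mod r = s" using N by simp_all
  ultimately have "m = q" "k = s" by simp_all
  then show ?thesis using eq sz by simp
qed

text \<open>The exchange is used backwards: if some part besides a largest one exceeded 1, moving a
  unit from it to the largest would lower the weight.\<close>

lemma forest_weight_min_unbalanced:
  assumes M: "M \<in> positive_partitions N r" and r: "r \<ge> 1"
    and min: "\<And>M'. M' \<in> positive_partitions N r \<Longrightarrow> forest_weight M \<le> forest_weight M'"
  shows "M = add_mset (N - r + 1) (replicate_mset (r - 1) 1)"
proof -
  have M': "size M = r" "0 \<notin># M" "sum_mset M = N" using M by (auto simp: positive_partitions_def)
  have ne: "set_mset M \<noteq> {}" using M'(1) r by auto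
  define m where "m = Max (set_mset M)"
  have mM: "m \<in># M" unfolding m_def using ne by (intro Max_in) auto
  then obtain K where K: "M = add_mset m K" by (metis insert_DiffM)
  have "x = 1" if x: "x \<in># K" for x
  proof (rule ccontr)
    assume "x \<noteq> 1"
    moreover have "x \<in># M" using K x by simp
    then have "x \<noteq> 0" using M'(2) by (intro notI) simp
    ultimately have x2: "x \<ge> 2" by simp
    obtain L where L: "K = add_mset x L" using x by (metis insert_DiffM)
    have xm: "x \<le> m" using \<open>x \<in># M\<close> unfolding m_def by simp
    have "add_mset (m + 1) (add_mset (x - 1) L) \<in> positive_partitions N r"
      using M' K L x2 by (auto simp: positive_partitions_def)
    then have "forest_weight M \<le> forest_weight (add_mset (m + 1) (add_mset (x - 1) L))" by (rule min)
    moreover have "forest_weight (add_mset (m + 1) (add_mset (x - 1) L)) < forest_weight (add_mset (m + 1 - 1) (add_mset (x - 1 + 1) L))"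
      using M' K L x2 xm by (intro forest_weight_exchange) auto
    ultimately show False using K L x2 by simp
  qed
  then have "K = replicate_mset (size K) 1"
    by (intro set_mset_subset_singletonD) auto
  moreover have "size K = r - 1" using M' K by simp
  ultimately have K1: "K = replicate_mset (r - 1) 1" by simp
  then have "m + (r - 1) = N" using M' K by simp
  then have "m = N - r + 1" using r M' K mM by (cases m) auto
  with K K1 show ?thesis by simp
qed

lemma forest_weight_balanced:
  "forest_weight (replicate_mset s (q + 1) + replicate_mset t q) =
     real (fib (2 * (q + 1))) ^ s * real (fib (2 * q)) ^ t *
     (real s * ((real (lucas (2 * (q + 1))) - 2) / real (fib (2 * (q + 1)))) +
      real t * ((real (lucas (2 * q)) - 2) / real (fib (2 * q))))"
proof -
  have "(\<Prod>d\<in>#replicate_mset n a. g d) = (g a :: real) ^ n" for n and a :: nat and g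
    by (induction n) auto
  moreover have "(\<Sum>d\<in>#replicate_mset n a. g d) = real n * (g a :: real)" for n and a :: nat and g
    by (induction n) (auto simp: algebra_simps)
  ultimately show ?thesis by (simp add: forest_weight_def del: fib.simps lucas.simps mult_Suc_right)
qed

text \<open>Since F_2 = 1 and L_2 - 2 = 1, each part 1 leaves the product alone and adds 1 to the
  sum.\<close>

lemma forest_weight_unbalanced:
  assumes "m > 0"
  shows "forest_weight (add_mset m (replicate_mset n 1)) =
    real (lucas (2 * m)) - 2 + real n * real (fib (2 * m))"
proof -
  have "(\<Prod>d\<in>#replicate_mset n 1. real (fib (2 * d))) = 1"
    by (induction n) auto
  moreover have "(\<Sum>d\<in>#replicate_mset n 1. (real (lucas (2 * d)) - 2) / real (fib (2 * d))) = real n"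
    by (induction n) (auto simp: numeral_eq_Suc)
  moreover have "fib (2 * m) \<noteq> 0" using assms by (simp add: fib_neq_0_nat)
  ultimately show ?thesis by (simp add: forest_weight_def field_simps)
qed

section \<open>Counting words without an up-down factor\<close>

datatype move = Down | Up | Hub

lemma UNIV_move: "UNIV = {Down, Up, Hub}"
  by (auto intro: move.exhaust)

text \<open>The set \<open>S\<close> may have gaps, and the restriction binds only positions that
  are adjacent within \<open>S\<close>. \<open>Up\<close> followed by \<open>Down\<close> means two
  rim vertices choosing each other as parents.\<close>

definition words :: "nat set \<Rightarrow> (nat \<Rightarrow> move) set" where
  "words S = {w \<in> S \<rightarrow>\<^sub>E UNIV. \<forall>t. t \<in> S \<longrightarrow> Suc t \<in> S \<longrightarrow> \<not> (w t = Up \<and> w (Suc t) = Down)}"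

lemma finite_words: "finite S \<Longrightarrow> finite (words S)"
  unfolding words_def by (rule finite_subset[of _ "S \<rightarrow>\<^sub>E UNIV"]) (auto intro!: finite_PiE simp: UNIV_move)

lemma card_words_empty: "card (words {}) = 1"
  by (simp add: words_def)

text \<open>At least one position separates \<open>A\<close> from \<open>B\<close>, so no
  restriction links them and words restrict independently.\<close>

lemma card_words_Un:
  assumes "\<And>x y. x \<in> A \<Longrightarrow> y \<in> B \<Longrightarrow> Suc x < y"
  shows "card (words (A \<union> B)) = card (words A) * card (words B)"
proof -
  have "bij_betw (\<lambda>w. (restrict w A, restrict w B)) (words (A \<union> B)) (words A \<times> words B)"
  proof (rule bij_betw_byWitness[where f' = "\<lambda>(u, v) t. if t \<in> A then u t else v t"])
    have disj: "t \<notin> B" if "t \<in> A" for t using assms[of t t] that by auto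
    have AB: "Suc t \<notin> B" if "t \<in> A" for t using assms[of t "Suc t"] that by auto
    have BA: "Suc t \<notin> A" if "t \<in> B" for t using assms[of "Suc t" t] that by auto
    show "\<forall>w\<in>words (A \<union> B). (case (restrict w A, restrict w B) of (u, v) \<Rightarrow> \<lambda>t. if t \<in> A then u t else v t) = w"
      by (auto simp: words_def fun_eq_iff PiE_def extensional_def)
    show "\<forall>a'\<in>words A \<times> words B. (restrict (case a' of (u, v) \<Rightarrow> \<lambda>t. if t \<in> A then u t else v t) A,
              restrict (case a' of (u, v) \<Rightarrow> \<lambda>t. if t \<in> A then u t else v t) B) = a'"
      using disj by (fastforce simp: words_def fun_eq_iff PiE_def extensional_def)
    show "(\<lambda>w. (restrict w A, restrict w B)) ` words (A \<union> B) \<subseteq> words A \<times> words B"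
      by (auto simp: words_def)
    show "(\<lambda>(u, v) t. if t \<in> A then u t else v t) ` (words A \<times> words B) \<subseteq> words (A \<union> B)"
      using disj AB BA by (auto simp: words_def PiE_def extensional_def split: if_splits)
  qed
  from bij_betw_same_card[OF this] show ?thesis by (simp add: card_cartesian_product)
qed

text \<open>The cut points \<open>b i\<close> separate the blocks. A block may be smaller than its
  arc, as happens once part of the arc is pinned.\<close>

lemma card_words_UN:
  assumes "\<And>i. i < n \<Longrightarrow> b i \<le> b (Suc i)" and "\<And>i. i < n \<Longrightarrow> A i \<subseteq> {b i<..<b (Suc i)}"
  shows "card (words (\<Union>i<n. A i)) = (\<Prod>i<n. card (words (A i)))"
  using assms
proof (induction n)
  case 0
  then show ?case by (simp add: card_words_empty)
next
  case (Suc n)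
  have le: "b i \<le> b n" if "i \<le> n" for i
    using that
  proof (induction rule: inc_induct)
    case (step m)
    then show ?case using Suc.prems(1)[of m] by simp
  qed simp
  have "card (words ((\<Union>i<n. A i) \<union> A n)) = card (words (\<Union>i<n. A i)) * card (words (A n))"
  proof (rule card_words_Un)
    fix x y assume "x \<in> (\<Union>i<n. A i)" "y \<in> A n"
    then obtain i where "i < n" "x \<in> A i" by auto
    then have "x < b (Suc i)" "b (Suc i) \<le> b n" using Suc.prems(2)[of i] le[of "Suc i"] by auto
    moreover have "b n < y" using \<open>y \<in> A n\<close> Suc.prems(2)[of n] by auto
    ultimately show "Suc x < y" by linarith
  qed
  with Suc show ?case by (simp add: lessThan_Suc Un_commute mult.commute)
qed

text \<open>A block of \<open>Up\<close> restricts only the position after it and a block of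
  \<open>Down\<close> only the one before it. The closure hypotheses keep those positions out of
  \<open>S - I\<close>, so the remaining letters stay free.\<close>

lemma card_words_pin:
  assumes "I \<subseteq> S"
    and Up: "\<And>t. x = Up \<Longrightarrow> t \<in> I \<Longrightarrow> Suc t \<in> S \<Longrightarrow> Suc t \<in> I"
    and Down: "\<And>t. x = Down \<Longrightarrow> t \<in> S \<Longrightarrow> Suc t \<in> I \<Longrightarrow> t \<in> I"
  shows "card {w \<in> words S. \<forall>t\<in>I. w t = x} = card (words (S - I))"
proof -
  have "bij_betw (\<lambda>w. restrict w (S - I)) {w \<in> words S. \<forall>t\<in>I. w t = x} (words (S - I))"
  proof (rule bij_betw_byWitness[where f' = "\<lambda>u t. if t \<in> I then x else u t"])
    show "\<forall>w\<in>{w \<in> words S. \<forall>t\<in>I. w t = x}. (\<lambda>t. if t \<in> I then x else restrict w (S - I) t) = w"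
      by (auto simp: words_def PiE_def extensional_def fun_eq_iff)
    show "\<forall>u\<in>words (S - I). restrict (\<lambda>t. if t \<in> I then x else u t) (S - I) = u"
      by (auto simp: words_def PiE_def extensional_def fun_eq_iff)
    show "(\<lambda>w. restrict w (S - I)) ` {w \<in> words S. \<forall>t\<in>I. w t = x} \<subseteq> words (S - I)"
      by (auto simp: words_def)
    show "(\<lambda>u t. if t \<in> I then x else u t) ` words (S - I) \<subseteq> {w \<in> words S. \<forall>t\<in>I. w t = x}"
    proof
      fix w assume "w \<in> (\<lambda>u t. if t \<in> I then x else u t) ` words (S - I)"
      then obtain u where u: "u \<in> words (S - I)" and w: "w = (\<lambda>t. if t \<in> I then x else u t)"
        by blast
      have "\<not> (w t = Up \<and> w (Suc t) = Down)" if "t \<in> S" "Suc t \<in> S" for t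
        using that u Up[of t] Down[of t] unfolding w words_def by auto
      then show "w \<in> {w \<in> words S. \<forall>t\<in>I. w t = x}"
        using u assms(1) unfolding w words_def by (auto simp: PiE_def extensional_def)
    qed
  qed
  then show ?thesis by (rule bij_betw_same_card)
qed

lemma card_words_pin_down:
  assumes "b \<notin> S" "{b<..k} \<subseteq> S"
  shows "card {w \<in> words S. \<forall>t\<in>{b<..k}. w t = Down} = card (words (S - {b<..k}))"
proof (rule card_words_pin)
  fix t assume t: "t \<in> S" "Suc t \<in> {b<..k}"
  then have "t \<noteq> b" using assms(1) by blast
  with t(2) show "t \<in> {b<..k}" by simp
qed (use assms in auto)

lemma card_words_pin_up:
  assumes "b \<notin> S" "{k..<b} \<subseteq> S"
  shows "card {w \<in> words S. \<forall>t\<in>{k..<b}. w t = Up} = card (words (S - {k..<b}))"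
proof (rule card_words_pin)
  fix t assume t: "t \<in> {k..<b}" "Suc t \<in> S"
  then have "Suc t \<noteq> b" using assms(1) by blast
  with t(1) show "Suc t \<in> {k..<b}" by simp
qed (use assms in auto)

text \<open>No position of \<open>S\<close> precedes \<open>a\<close> directly, so all three letters
  are possible at \<open>a\<close>, except \<open>Up\<close> when the next letter is
  \<open>Down\<close>.\<close>

lemma card_words_insert:
  assumes "finite S" "a \<notin> S" "\<And>t. t \<in> S \<Longrightarrow> Suc t \<noteq> a"
  shows "card (words (insert a S)) + card {w \<in> words S. Suc a \<in> S \<and> w (Suc a) = Down} = 3 * card (words S)"
proof -
  let ?X = "{w \<in> words S. Suc a \<in> S \<and> w (Suc a) = Down}"
  have "bij_betw (\<lambda>w. (w a, restrict w S)) (words (insert a S)) (UNIV \<times> words S - {Up} \<times> ?X)"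
  proof (rule bij_betw_byWitness[where f' = "\<lambda>(x, u). u(a := x)"])
    show "(\<lambda>(x, u). u(a := x)) ` (UNIV \<times> words S - {Up} \<times> ?X) \<subseteq> words (insert a S)"
      using assms by (auto simp: words_def PiE_def extensional_def split: if_splits)
  qed (use assms in \<open>auto simp: words_def fun_eq_iff PiE_def extensional_def\<close>)
  then have "card (words (insert a S)) = card (UNIV \<times> words S - {Up} \<times> ?X)"
    by (rule bij_betw_same_card)
  also have "\<dots> = card ((UNIV :: move set) \<times> words S) - card ({Up} \<times> ?X)"
    using finite_words[OF assms(1)] by (intro card_Diff_subset) auto
  also have "\<dots> = 3 * card (words S) - card ?X"
    by (simp add: card_cartesian_product UNIV_move)
  finally show ?thesis
    using card_mono[OF finite_words[OF assms(1)], of ?X] by auto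
qed

text \<open>Adding a first letter gives three times the previous count minus the words starting with
  \<open>Down\<close>. Such a first letter does not restrict the rest, so these are counted by an
  interval shorter by one: the recurrence of F_{2n}.\<close>

lemma card_words_interval: "card (words {m<..<m + Suc n}) = fib (2 * Suc n)"
proof (induction n arbitrary: m rule: induct_nat_012)
  case 0
  have "{m<..<m + Suc 0} = {}" by auto
  then show ?case by (simp add: card_words_empty)
next
  case 1
  have "{m<..<m + Suc (Suc 0)} = insert (Suc m) {}" by auto
  then show ?case using card_words_insert[of "{}" "Suc m"] by (simp add: card_words_empty numeral_eq_Suc)
next
  case (ge2 n)
  let ?S = "{Suc m<..<Suc m + Suc (Suc n)}"
  have *: "{m<..<m + Suc (Suc (Suc n))} = insert (Suc m) ?S" by auto
  have **: "?S - {Suc m<..Suc (Suc m)} = {Suc (Suc m)<..<Suc (Suc m) + Suc n}" by auto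
  have "{w \<in> words ?S. Suc (Suc m) \<in> ?S \<and> w (Suc (Suc m)) = Down}
      = {w \<in> words ?S. \<forall>t\<in>{Suc m<..Suc (Suc m)}. w t = Down}"
    by (auto simp: le_Suc_eq)
  then have "card (words (insert (Suc m) ?S)) + fib (2 * Suc n) = 3 * fib (2 * Suc (Suc n))"
    using card_words_insert[of ?S "Suc m"] card_words_pin_down[of "Suc m" ?S "Suc (Suc m)"]
      ge2(1)[of "Suc (Suc m)"] ge2(2)[of "Suc m"] ** by (simp add: subset_iff)
  then show ?case using fib_even_rec[of "Suc n"] * by simp
qed

lemma card_words_arc: "x < y \<Longrightarrow> card (words {x<..<y}) = fib (2 * (y - x))"
  using card_words_interval[of x "y - Suc x"] by (simp add: Suc_diff_Suc del: fib.simps mult_Suc_right)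

lemma sum_fib_even: "(\<Sum>j<n. fib (2 * Suc j)) + 1 = fib (2 * n + 1)"
  by (induction n) auto

text \<open>The terms are the possible hub parents in one arc. The root at \<open>x\<close> leaves
  the whole arc free; an interior \<open>k\<close> leaves the part above it free if its path runs
  down, the part below it if the path runs up.\<close>

lemma lucas_even_sum:
  assumes "x < y"
  shows "lucas (2 * (y - x)) =
    fib (2 * (y - x)) + (\<Sum>k\<in>{x<..<y}. fib (2 * (y - k)) + fib (2 * (k - x))) + 2"
proof -
  obtain n where y: "y = x + Suc n" using assms less_iff_Suc_add by auto
  have "(\<Sum>k\<in>{x<..<y}. fib (2 * (y - k)) + fib (2 * (k - x))) =
        (\<Sum>j<n. fib (2 * (n - j)) + fib (2 * Suc j))"
  proof -
    have "{x<..<y} = (\<lambda>j. x + Suc j) ` {..<n}"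
      unfolding y by (auto simp: image_iff less_iff_Suc_add)
    then show ?thesis by (simp add: sum.reindex inj_on_def y del: mult_Suc_right)
  qed
  also have "\<dots> = (\<Sum>j<n. fib (2 * (n - j))) + (\<Sum>j<n. fib (2 * Suc j))"
    by (rule sum.distrib)
  also have "(\<Sum>j<n. fib (2 * (n - j))) = (\<Sum>j<n. fib (2 * Suc (n - Suc j)))"
    by (intro sum.cong) (auto simp: Suc_diff_Suc simp del: mult_Suc_right)
  also have "\<dots> = (\<Sum>j<n. fib (2 * Suc j))"
    by (rule sum.nat_diff_reindex)
  finally show ?thesis
    using sum_fib_even[of n] lucas_fib[of "2 * Suc n"] y by simp
qed

section \<open>Configurations on the arcs between the roots\<close>

text \<open>Root positions are \<open>b 0 < \<dots> < b (r - 1)\<close>, and \<open>b r\<close> is the first root again after a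
  full turn. A configuration pairs the parent \<open>k\<close> of the hub with the directions of the rim
  non-roots; \<open>chain\<close> says that from \<open>k\<close> these lead along the rim to a root at an end of its arc.\<close>

definition chain :: "(nat \<Rightarrow> nat) \<Rightarrow> nat \<Rightarrow> nat \<Rightarrow> (nat \<Rightarrow> move) \<Rightarrow> bool" where
  "chain b r k w \<longleftrightarrow> (\<exists>i<r. k = b i \<or>
     b i < k \<and> k < b (Suc i) \<and> ((\<forall>t\<in>{b i<..k}. w t = Down) \<or> (\<forall>t\<in>{k..<b (Suc i)}. w t = Up)))"

locale cut_points =
  fixes b :: "nat \<Rightarrow> nat" and r :: nat
  assumes less_Suc: "i < r \<Longrightarrow> b i < b (Suc i)"
begin

definition inner :: "nat set" where
  "inner = (\<Union>i<r. {b i<..<b (Suc i)})"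

definition configurations :: "(nat \<times> (nat \<Rightarrow> move)) set" where
  "configurations = (SIGMA k:{b 0..<b r}. {w \<in> words inner. chain b r k w})"

lemma b_mono: "i \<le> j \<Longrightarrow> j \<le> r \<Longrightarrow> b i \<le> b j"
proof (induction j rule: dec_induct)
  case (step n)
  then show ?case using less_Suc[of n] by simp
qed simp

lemma arc_unique:
  assumes "i < r" "j < r" "b i \<le> k" "k < b (Suc i)" "b j \<le> k" "k < b (Suc j)"
  shows "i = j"
proof (rule ccontr)
  assume "i \<noteq> j"
  then have "Suc i \<le> j \<or> Suc j \<le> i" by linarith
  then show False using b_mono[of "Suc i" j] b_mono[of "Suc j" i] assms by auto
qed

lemma b_notin_inner: "i \<le> r \<Longrightarrow> b i \<notin> inner"
proof
  assume i: "i \<le> r" "b i \<in> inner"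
  then obtain j where j: "j < r" "b j < b i" "b i < b (Suc j)" by (auto simp: inner_def)
  then have "i > j" "i < Suc j" using b_mono[of i j] b_mono[of "Suc j" i] i by (auto simp: not_le[symmetric])
  then show False by simp
qed

lemma ex_arc: "k \<in> {b 0..<b r} \<Longrightarrow> \<exists>i<r. b i \<le> k \<and> k < b (Suc i)"
proof -
  assume k: "k \<in> {b 0..<b r}"
  define i where "i = (LEAST i. k < b i)"
  have "k < b i" unfolding i_def by (rule LeastI[of _ r]) (use k in auto)
  moreover have "i \<le> r" unfolding i_def by (rule Least_le) (use k in auto)
  moreover have "i \<noteq> 0" using \<open>k < b i\<close> k by (cases "i = 0") auto
  moreover from this have "\<not> k < b (i - 1)" unfolding i_def by (intro not_less_Least) auto
  ultimately show ?thesis by (intro exI[of _ "i - 1"]) auto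
qed

lemma arc_cases:
  assumes "k \<in> {b 0..<b r}"
  obtains i where "i < r" "k = b i" | i where "i < r" "b i < k" "k < b (Suc i)"
  using ex_arc[OF assms] by (auto simp: order_le_less)

lemma inner_bounds: "inner \<subseteq> {b 0<..<b r}"
proof
  fix t assume "t \<in> inner"
  then obtain i where "i < r" "b i < t" "t < b (Suc i)" by (auto simp: inner_def)
  then show "t \<in> {b 0<..<b r}" using b_mono[of 0 i] b_mono[of "Suc i" r] by simp
qed

lemma finite_inner: "finite inner"
  by (simp add: inner_def)

lemma sum_arcs: "(\<Sum>k\<in>{b 0..<b r}. g k) = (\<Sum>i<r. \<Sum>k\<in>{b i..<b (Suc i)}. g k)"
proof -
  have "n \<le> r \<Longrightarrow> (\<Sum>k\<in>{b 0..<b n}. g k) = (\<Sum>i<n. \<Sum>k\<in>{b i..<b (Suc i)}. g k)" for n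
  proof (induction n)
    case (Suc n)
    then show ?case
      using sum.atLeastLessThan_concat[of "b 0" "b n" "b (Suc n)" g] b_mono[of 0 n] less_Suc[of n] by simp
  qed simp
  then show ?thesis by simp
qed

section \<open>Counting configurations arc by arc\<close>

lemma card_words_inner: "card (words inner) = (\<Prod>i<r. fib (2 * (b (Suc i) - b i)))"
  unfolding inner_def
  by (subst card_words_UN[where b = b]) (auto simp: card_words_arc less_Suc less_imp_le intro!: prod.cong)

text \<open>Pinning the path from \<open>k\<close> to one end of arc \<open>i\<close> leaves a
  shorter free interval, and only the factor of that arc changes.\<close>

lemma card_words_inner_replace:
  assumes i: "i < r" and xy: "b i \<le> x" "x < y" "y \<le> b (Suc i)"
  shows "card (words (inner - ({b i<..<b (Suc i)} - {x<..<y}))) =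
     fib (2 * (y - x)) * (\<Prod>j\<in>{..<r} - {i}. fib (2 * (b (Suc j) - b j)))"
proof -
  let ?A = "\<lambda>j. if j = i then {x<..<y} else {b j<..<b (Suc j)}"
  have "inner - ({b i<..<b (Suc i)} - {x<..<y}) = (\<Union>j<r. ?A j)" (is "?L = ?R")
  proof (intro equalityI subsetI)
    fix k assume "k \<in> ?L"
    then show "k \<in> ?R" by (fastforce simp: inner_def)
  next
    fix k assume "k \<in> ?R"
    then obtain j where "j \<in> {..<r}" and j: "k \<in> ?A j" by (rule UN_E)
    then have j: "j < r" "k \<in> ?A j" by simp_all
    then have jk: "b j < k" "k < b (Suc j)" using xy by (auto split: if_splits)
    with j have "k \<in> inner" by (auto simp: inner_def)
    moreover have "j = i" if "k \<in> {b i<..<b (Suc i)}"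
      using arc_unique[OF j(1) i, of k] that jk by auto
    ultimately show "k \<in> ?L" using j by (cases "j = i") auto
  qed
  then have "card (words ?L) = (\<Prod>j<r. card (words (?A j)))"
    using xy by (simp only:) (subst card_words_UN[where b = b], auto simp: less_Suc less_imp_le split: if_splits)
  also have "\<dots> = card (words (?A i)) * (\<Prod>j\<in>{..<r} - {i}. card (words (?A j)))"
    using i by (intro prod.remove) auto
  also have "(\<Prod>j\<in>{..<r} - {i}. card (words (?A j))) = (\<Prod>j\<in>{..<r} - {i}. fib (2 * (b (Suc j) - b j)))"
    by (intro prod.cong) (auto simp: card_words_arc less_Suc)
  finally show ?thesis using xy by (simp add: card_words_arc)
qed

lemma card_chain_root:
  assumes "i < r"
  shows "card {w \<in> words inner. chain b r (b i) w} =
     fib (2 * (b (Suc i) - b i)) * (\<Prod>j\<in>{..<r} - {i}. fib (2 * (b (Suc j) - b j)))"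
proof -
  have "{w \<in> words inner. chain b r (b i) w} = words inner" using assms by (auto simp: chain_def)
  then show ?thesis using assms by (simp add: card_words_inner prod.remove[of "{..<r}" i])
qed

text \<open>The path from \<open>k\<close> descends or ascends to an end of its arc. The two cases
  exclude each other at the letter of \<open>k\<close> itself, so their counts add.\<close>

lemma card_chain_inner:
  assumes i: "i < r" and k: "b i < k" "k < b (Suc i)"
  shows "card {w \<in> words inner. chain b r k w} =
     (fib (2 * (b (Suc i) - k)) + fib (2 * (k - b i))) * (\<Prod>j\<in>{..<r} - {i}. fib (2 * (b (Suc j) - b j)))"
proof -
  let ?D = "{w \<in> words inner. \<forall>t\<in>{b i<..k}. w t = Down}"
  let ?U = "{w \<in> words inner. \<forall>t\<in>{k..<b (Suc i)}. w t = Up}"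
  have "chain b r k w \<longleftrightarrow> (\<forall>t\<in>{b i<..k}. w t = Down) \<or> (\<forall>t\<in>{k..<b (Suc i)}. w t = Up)" for w
  proof
    assume "chain b r k w"
    then obtain j where j: "j < r" "k = b j \<or>
     b j < k \<and> k < b (Suc j) \<and> ((\<forall>t\<in>{b j<..k}. w t = Down) \<or> (\<forall>t\<in>{k..<b (Suc j)}. w t = Up))"
      unfolding chain_def by blast
    then have "j = i" using arc_unique[of j i k] i k less_Suc[of j] by auto
    with j k show "(\<forall>t\<in>{b i<..k}. w t = Down) \<or> (\<forall>t\<in>{k..<b (Suc i)}. w t = Up)" by auto
  qed (use i k in \<open>auto simp: chain_def\<close>)
  then have "{w \<in> words inner. chain b r k w} = ?D \<union> ?U" by auto
  moreover have "?D \<inter> ?U = {}" using k by force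
  ultimately have "card {w \<in> words inner. chain b r k w} = card ?D + card ?U"
    using finite_words[OF finite_inner] by (simp add: card_Un_disjoint)
  moreover have "{b i<..k} = {b i<..<b (Suc i)} - {k<..<b (Suc i)}"
    "{k..<b (Suc i)} = {b i<..<b (Suc i)} - {b i<..<k}" using k by auto
  moreover have "{b i<..k} \<subseteq> inner" "{k..<b (Suc i)} \<subseteq> inner"
    using i k by (force simp: inner_def)+
  ultimately show ?thesis
    using i k card_words_pin_down[of "b i" inner k] card_words_pin_up[of "b (Suc i)" inner k]
      card_words_inner_replace[OF i, of k "b (Suc i)"] card_words_inner_replace[OF i, of "b i" k]
      b_notin_inner[of i] b_notin_inner[of "Suc i"]
    by (simp add: add_mult_distrib)
qed

lemma card_configurations:
  "card configurations =
     (\<Sum>i<r. (lucas (2 * (b (Suc i) - b i)) - 2) * (\<Prod>j\<in>{..<r} - {i}. fib (2 * (b (Suc j) - b j))))"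
proof -
  have "card configurations = (\<Sum>k\<in>{b 0..<b r}. card {w \<in> words inner. chain b r k w})"
    unfolding configurations_def
    by (rule card_SigmaI) (auto simp: finite_words finite_inner)
  also have "\<dots> = (\<Sum>i<r. \<Sum>k\<in>{b i..<b (Suc i)}. card {w \<in> words inner. chain b r k w})"
    by (rule sum_arcs)
  also have "\<dots> = (\<Sum>i<r. (lucas (2 * (b (Suc i) - b i)) - 2) * (\<Prod>j\<in>{..<r} - {i}. fib (2 * (b (Suc j) - b j))))"
  proof (rule sum.cong)
    fix i assume "i \<in> {..<r}"
    then have i: "i < r" by simp
    have "{b i..<b (Suc i)} = insert (b i) {b i<..<b (Suc i)}" using less_Suc[OF i] by auto
    then have "(\<Sum>k\<in>{b i..<b (Suc i)}. card {w \<in> words inner. chain b r k w}) =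
      (fib (2 * (b (Suc i) - b i)) + (\<Sum>k\<in>{b i<..<b (Suc i)}. fib (2 * (b (Suc i) - k)) + fib (2 * (k - b i))))
       * (\<Prod>j\<in>{..<r} - {i}. fib (2 * (b (Suc j) - b j)))"
      by (simp add: card_chain_root[OF i] card_chain_inner[OF i] add_mult_distrib sum_distrib_right sum.distrib)
    then show "(\<Sum>k\<in>{b i..<b (Suc i)}. card {w \<in> words inner. chain b r k w}) =
      (lucas (2 * (b (Suc i) - b i)) - 2) * (\<Prod>j\<in>{..<r} - {i}. fib (2 * (b (Suc j) - b j)))"
      using lucas_even_sum[OF less_Suc[OF i]] by simp
  qed simp
  finally show ?thesis .
qed

lemma card_configurations_eq_forest_weight:
  "real (card configurations) = forest_weight (image_mset (\<lambda>i. b (Suc i) - b i) (mset_set {..<r}))"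
proof -
  let ?F = "\<lambda>i. real (fib (2 * (b (Suc i) - b i)))" and ?L = "\<lambda>i. real (lucas (2 * (b (Suc i) - b i))) - 2"
  have "real (card configurations) = (\<Sum>i<r. ?L i * (\<Prod>j\<in>{..<r} - {i}. ?F j))"
    unfolding card_configurations using lucas_even_ge less_Suc
    by (auto simp: of_nat_diff less_imp_le intro!: sum.cong)
  also have "\<dots> = (\<Sum>i<r. (\<Prod>j<r. ?F j) * (?L i / ?F i))"
    using less_Suc by (auto simp: prod.remove fib_neq_0_nat[THEN less_imp_neq, symmetric] intro!: sum.cong)
  also have "\<dots> = (\<Prod>j<r. ?F j) * (\<Sum>i<r. ?L i / ?F i)"
    by (rule sum_distrib_left[symmetric])
  finally show ?thesis
    by (simp add: forest_weight_def prod_unfold_prod_mset sum_unfold_sum_mset comp_def multiset.map_comp)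
qed

end

section \<open>Rooted forests of the wheel\<close>

text \<open>Rim vertices are unrolled along the natural numbers, with an index shift: position \<open>t\<close>
  is the vertex $v_{(t \bmod N) + 1}$, so that stepping up is \<open>Suc\<close> also across the seam.\<close>

definition rim_pos :: "nat \<Rightarrow> nat \<Rightarrow> wheel_vertex" where
  "rim_pos N t = Rim (t mod N + 1)"

lemma mod_inj_window:
  fixes N s t :: nat
  assumes "s mod N = t mod N" "a \<le> s" "s < a + N" "a \<le> t" "t < a + N"
  shows "s = t"
proof -
  have "N dvd (if s \<le> t then t - s else s - t)"
    using assms(1) mod_eq_dvd_iff_nat[of s t N] mod_eq_dvd_iff_nat[of t s N] by auto
  then show ?thesis using assms(2-) by (auto dest: dvd_imp_le split: if_splits)
qed

lemma rim_pos_inj: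
  "rim_pos N s = rim_pos N t \<Longrightarrow> a \<le> s \<Longrightarrow> s < a + N \<Longrightarrow> a \<le> t \<Longrightarrow> t < a + N \<Longrightarrow> s = t"
  by (auto simp: rim_pos_def intro: mod_inj_window)

lemma rim_pos_add [simp]: "rim_pos N (t + N) = rim_pos N t"
  by (simp add: rim_pos_def)

lemma rim_eq_image_rim_pos: "rim N = rim_pos N ` {a..<a + N}"
proof (cases "N = 0")
  case False
  have "(\<lambda>t. t mod N + 1) ` {a..<a + N} = {1..N}"
  proof (rule card_subset_eq)
    have "inj_on (\<lambda>t. t mod N + 1) {a..<a + N}"
      by (rule inj_onI) (auto intro: mod_inj_window)
    then show "card ((\<lambda>t. t mod N + 1) ` {a..<a + N}) = card {1..N}"
      by (simp add: card_image)
  qed (use False in \<open>auto simp: Suc_le_eq\<close>)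
  then show ?thesis
    unfolding rim_def rim_pos_def by (metis (no_types) image_image)
qed (simp add: rim_def)

lemma rim_pos_in_rim: "N > 0 \<Longrightarrow> rim_pos N t \<in> rim N"
  by (auto simp: rim_pos_def rim_def Suc_le_eq)

lemma wheel_spoke: "N > 0 \<Longrightarrow> {Center, rim_pos N t} \<in> edges (wheel N)"
  by (auto simp: wheel_def rim_pos_def Suc_le_eq)

lemma wheel_rim_edge:
  assumes "N > 0"
  shows "{rim_pos N t, rim_pos N (Suc t)} \<in> edges (wheel N)"
proof -
  have "{rim_pos N t, rim_pos N (Suc t)} = (\<lambda>i. {Rim i, Rim (i mod N + 1)}) (t mod N + 1)"
    by (simp add: rim_pos_def mod_Suc_eq)
  moreover have "t mod N + 1 \<in> {1..N}" using assms by (simp add: Suc_le_eq)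
  ultimately show ?thesis unfolding wheel_def by auto
qed

lemma wheel_neighbours:
  assumes "{rim_pos N t, v} \<in> edges (wheel N)" "t > 0" "N > 0"
  shows "v = Center \<or> v = rim_pos N (t - 1) \<or> v = rim_pos N (Suc t)"
proof -
  consider i where "i \<in> {1..N}" "{rim_pos N t, v} = {Rim i, Rim (i mod N + 1)}"
    | i where "{rim_pos N t, v} = {Center, Rim i}"
    using assms(1) by (auto simp: wheel_def)
  then show ?thesis
  proof cases
    case 1
    then consider "rim_pos N t = Rim i" "v = Rim (i mod N + 1)"
      | "rim_pos N t = Rim (i mod N + 1)" "v = Rim i"
      by (auto simp: doubleton_eq_iff)
    then show ?thesis
    proof cases
      case 1
      then show ?thesis by (auto simp: rim_pos_def mod_Suc_eq)
    next
      case 2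
      \<comment> \<open>Writing both indices as successors allows a step to be cancelled modulo
        \<open>N\<close>, also across the seam.\<close>
      obtain j u where ju: "i = Suc j" "t = Suc u"
        using 1 assms(2) by (metis atLeastAtMost_iff gr0_implies_Suc not_one_le_zero zero_less_iff_neq_zero)
      have "Suc u mod N = Suc j mod N" using 2 ju by (simp add: rim_pos_def)
      then have "u mod N = j mod N" using \<open>N > 0\<close> by (auto simp: mod_Suc split: if_splits)
      moreover have "j mod N = j" using 1 ju by simp
      ultimately show ?thesis using 2 ju by (simp add: rim_pos_def)
    qed
  next
    case 2
    then show ?thesis by (auto simp: doubleton_eq_iff rim_pos_def)
  qed
qed

lemma wheel_center_neighbours: "{Center, v} \<in> edges (wheel N) \<Longrightarrow> v \<in> rim N"
  by (auto simp: wheel_def rim_def doubleton_eq_iff)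

lemma simple_graph_wheel:
  assumes "N \<ge> 3"
  shows "simple_graph (wheel N)"
proof -
  have "i mod N + 1 \<in> {1..N} \<and> i mod N + 1 \<noteq> i" if "i \<in> {1..N}" for i
    using that assms by (cases "i = N") (auto simp: Suc_le_eq)
  then show ?thesis
    unfolding simple_graph_def wheel_def rim_def
    by (fastforce simp: card_2_iff doubleton_eq_iff)
qed

section \<open>Configurations as parent functions of the wheel\<close>

locale rim_roots = cut_points +
  fixes N :: nat
  assumes N3: "N \<ge> 3" and r_pos: "r \<ge> 1" and period: "b r = b 0 + N"
begin

abbreviation roots :: "wheel_vertex set" where
  "roots \<equiv> rim_pos N ` b ` {..<r}"

fun target :: "move \<Rightarrow> nat \<Rightarrow> wheel_vertex" where
  "target Down t = rim_pos N (t - 1)"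
| "target Up t = rim_pos N (Suc t)"
| "target Hub t = Center"

definition pos :: "wheel_vertex \<Rightarrow> nat" where
  "pos = inv_into {b 0..<b r} (rim_pos N)"

definition parent_of :: "nat \<times> (nat \<Rightarrow> move) \<Rightarrow> wheel_vertex \<Rightarrow> wheel_vertex" where
  "parent_of c = restrict
     (\<lambda>v. case v of Center \<Rightarrow> rim_pos N (fst c) | Rim _ \<Rightarrow> target (snd c (pos v)) (pos v))
     (insert Center (rim_pos N ` inner))"

lemma N_pos: "N > 0"
  using N3 by simp

lemma pos_rim_pos: "t \<in> {b 0..<b r} \<Longrightarrow> pos (rim_pos N t) = t"
  unfolding pos_def
  by (rule inv_into_f_f) (auto intro!: inj_onI simp: period elim: rim_pos_inj)

lemma inner_window: "t \<in> inner \<Longrightarrow> b 0 < t \<and> t < b r"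
  using inner_bounds by auto

lemma window_cases: "t \<in> {b 0..<b r} \<Longrightarrow> t \<in> b ` {..<r} \<or> t \<in> inner"
  by (erule arc_cases) (auto simp: inner_def)

lemma rim_pos_b_r: "rim_pos N (b r) = rim_pos N (b 0)"
  by (simp add: period)

lemma nonroots: "vertices (wheel N) - roots = insert Center (rim_pos N ` inner)"
proof -
  have "rim_pos N t \<notin> roots" if "t \<in> inner" for t
  proof
    assume "rim_pos N t \<in> roots"
    then obtain i where i: "i < r" "rim_pos N t = rim_pos N (b i)" by auto
    have "b 0 \<le> b i" "b i < b r"
      using b_mono[of 0 i] b_mono[of "Suc i" r] less_Suc[of i] i by auto
    with i inner_window[OF that] have "t = b i"
      using rim_pos_inj[of N t "b i" "b 0"] period by simp
    with that b_notin_inner[of i] i show False by simp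
  qed
  moreover have "rim N \<subseteq> roots \<union> rim_pos N ` inner"
    using window_cases unfolding rim_eq_image_rim_pos[of N "b 0"] period[symmetric] by blast
  moreover have "Center \<notin> roots" by (auto simp: rim_pos_def)
  moreover have "rim_pos N ` inner \<subseteq> rim N" using rim_pos_in_rim[OF N_pos] by blast
  ultimately show ?thesis by (auto simp: wheel_def)
qed

lemma parent_of_Center: "parent_of (k, w) Center = rim_pos N k"
  by (simp add: parent_of_def)

lemma parent_of_rim_pos: "t \<in> inner \<Longrightarrow> parent_of (k, w) (rim_pos N t) = target (w t) t"
  using inner_window[of t] pos_rim_pos[of t] by (simp add: parent_of_def) (simp add: rim_pos_def)

text \<open>The two rim neighbours of a position lie two steps apart, hence are different vertices
  because \<open>N\<close> is at least 3.\<close>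

lemma target_inj:
  assumes "t \<in> inner" "target x t = target y t"
  shows "x = y"
proof -
  have "t - 1 \<noteq> Suc t" "t - 1 \<le> Suc t" "Suc t < t - 1 + N" using inner_window[OF assms(1)] N3 by auto
  then have "rim_pos N (t - 1) \<noteq> rim_pos N (Suc t)"
    using rim_pos_inj[of N "t - 1" "Suc t" "t - 1"] by auto
  with assms(2) show ?thesis by (cases x; cases y) (auto simp: rim_pos_def)
qed

lemma inj_on_parent_of: "inj_on parent_of configurations"
proof (rule inj_onI, clarify)
  fix k w k' w'
  assume c: "(k, w) \<in> configurations" "(k', w') \<in> configurations"
    and eq: "parent_of (k, w) = parent_of (k', w')"
  have "rim_pos N k = rim_pos N k'" using eq by (metis parent_of_Center)
  then have "k = k'"
    using c period rim_pos_inj[of N k k' "b 0"] by (simp add: configurations_def)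
  moreover have "w t = w' t" if "t \<in> inner" for t
    using target_inj[OF that] eq that by (metis parent_of_rim_pos)
  then have "w = w'"
    using c by (intro PiE_ext[of w inner "\<lambda>_. UNIV"]) (auto simp: configurations_def words_def)
  ultimately show "k = k' \<and> w = w'" by simp
qed

lemma inner_Suc: "t \<in> inner \<Longrightarrow> Suc t \<in> inner \<or> Suc t \<in> b ` {..r}"
proof -
  assume "t \<in> inner"
  then obtain i where i: "i < r" "b i < t" "t < b (Suc i)" by (auto simp: inner_def)
  then have "Suc t = b (Suc i) \<or> b i < Suc t \<and> Suc t < b (Suc i)" by auto
  then show ?thesis using i(1) by (auto simp: inner_def)
qed

lemma inner_pred: "t \<in> inner \<Longrightarrow> t - 1 \<in> inner \<or> t - 1 \<in> b ` {..r}"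
proof -
  assume "t \<in> inner"
  then obtain i where i: "i < r" "b i < t" "t < b (Suc i)" by (auto simp: inner_def)
  then have "t - 1 = b i \<or> b i < t - 1 \<and> t - 1 < b (Suc i)" by auto
  then show ?thesis using i(1) by (auto simp: inner_def)
qed

text \<open>\<open>I\<close> collects the non-roots on the path from the hub's parent to a root. It
  gives one description of the three cases of \<open>chain\<close>, closed under parents up to
  roots, for use in defining heights.\<close>

lemma chain_inner_set:
  assumes "k \<in> {b 0..<b r}" "chain b r k w" "w \<in> words inner"
  obtains I where "I \<subseteq> inner" "k \<in> b ` {..r} \<or> k \<in> I" "\<And>t. t \<in> I \<Longrightarrow> w t \<noteq> Hub"
    "\<And>t. t \<in> I \<Longrightarrow> w t = Down \<Longrightarrow> t - 1 \<in> b ` {..r} \<union> I"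
    "\<And>t. t \<in> I \<Longrightarrow> w t = Up \<Longrightarrow> Suc t \<in> b ` {..r} \<union> I"
proof -
  from assms(2) consider i where "i < r" "k = b i"
    | i where "i < r" "b i < k" "k < b (Suc i)" "\<forall>t\<in>{b i<..k}. w t = Down"
    | i where "i < r" "b i < k" "k < b (Suc i)" "\<forall>t\<in>{k..<b (Suc i)}. w t = Up"
    unfolding chain_def by blast
  then show ?thesis
  proof cases
    case 1
    then show ?thesis by (intro that[of "{}"]) auto
  next
    case 2
    show ?thesis
    proof (rule that[of "{b i<..k}"])
      fix t assume t: "t \<in> {b i<..k}"
      then show "t - 1 \<in> b ` {..r} \<union> {b i<..k}"
        using 2 by (cases "t - 1 = b i") auto
    qed (use 2 in \<open>auto simp: inner_def\<close>)
  next
    case 3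
    show ?thesis
    proof (rule that[of "{k..<b (Suc i)}"])
      fix t assume t: "t \<in> {k..<b (Suc i)}"
      then show "Suc t \<in> b ` {..r} \<union> {k..<b (Suc i)}"
        using 3 by (cases "Suc t = b (Suc i)") auto
    qed (use 3 in \<open>auto simp: inner_def\<close>)
  qed
qed

lemma parent_of_height:
  assumes c: "(k, w) \<in> configurations"
  shows "\<exists>h :: _ \<Rightarrow> nat. \<forall>v\<in>insert Center (rim_pos N ` inner). h (parent_of (k, w) v) < h v"
proof -
  have k: "k \<in> {b 0..<b r}" and w: "w \<in> words inner" and "chain b r k w"
    using c by (auto simp: configurations_def)
  from chain_inner_set[OF k this(3) w] obtain I where
    I: "I \<subseteq> inner" "k \<in> b ` {..r} \<or> k \<in> I" "\<And>t. t \<in> I \<Longrightarrow> w t \<noteq> Hub"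
    "\<And>t. t \<in> I \<Longrightarrow> w t = Down \<Longrightarrow> t - 1 \<in> b ` {..r} \<union> I"
    "\<And>t. t \<in> I \<Longrightarrow> w t = Up \<Longrightarrow> Suc t \<in> b ` {..r} \<union> I"
    by blast
  \<comment> \<open>Heights form layers: roots at 0, the path \<open>I\<close> at most
    \<open>b r\<close>, the hub at \<open>b r + 1\<close>, vertices pointing to the hub at
    \<open>b r + 2\<close>, and all other rim vertices above. Within a layer the height falls in the
    direction pointed to.\<close>
  define off where "off t = (if t \<in> I then 0 else b r + 3)" for t
  define H where "H t = (if t \<in> b ` {..r} then 0 else
     case w t of Hub \<Rightarrow> b r + 2 | Down \<Rightarrow> t + off t | Up \<Rightarrow> b r - t + off t)" for t
  define h where "h v = (case v of Center \<Rightarrow> b r + 1 | Rim _ \<Rightarrow> H (pos v))" for v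
  have root: "H t = 0" if "t \<in> b ` {..r}" for t using that by (simp add: H_def)
  \<comment> \<open>The endpoint \<open>b r\<close> is included: it is the same vertex as
    \<open>b 0\<close>, and both positions receive height 0.\<close>
  have h_rim: "h (rim_pos N t) = H t" if "t \<in> {b 0..b r}" for t
  proof (cases "t = b r")
    case True
    have "b 0 < b r" using period N3 by simp
    then have "h (rim_pos N t) = H (b 0)"
      using True pos_rim_pos[of "b 0"] by (simp add: rim_pos_b_r h_def) (simp add: rim_pos_def)
    then show ?thesis using root[of t] root[of "b 0"] True by simp
  next
    case False
    then show ?thesis
      using that pos_rim_pos[of t] by (simp add: h_def) (simp add: rim_pos_def)
  qed
  have notroot: "t \<notin> b ` {..r}" if "t \<in> inner" for t
    using that b_notin_inner by auto
  have noUD: "\<not> (w t = Up \<and> w (Suc t) = Down)" if "t \<in> inner" "Suc t \<in> inner" for t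
    using w that by (simp add: words_def)
  have Hdown: "H (t - 1) < H t" if t: "t \<in> inner" "w t = Down" for t
  proof -
    note b = inner_window[OF t(1)]
    have "w (t - 1) \<noteq> Up" if "t - 1 \<in> inner"
      using noUD[of "t - 1"] that t b by auto
    then show ?thesis
      using inner_pred[OF t(1)] I(3)[of "t - 1"] I(4)[of t] t b notroot[OF t(1)] notroot[of "t - 1"]
      by (cases "w (t - 1)") (auto simp: H_def off_def)
  qed
  have Hup: "H (Suc t) < H t" if t: "t \<in> inner" "w t = Up" for t
  proof -
    note b = inner_window[OF t(1)]
    have "w (Suc t) \<noteq> Down" if "Suc t \<in> inner"
      using noUD[of t] that t by auto
    then show ?thesis
      using inner_Suc[OF t(1)] I(3)[of "Suc t"] I(5)[of t] t b notroot[OF t(1)] notroot[of "Suc t"]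
        inner_window[of "Suc t"]
      by (cases "w (Suc t)") (auto simp: H_def off_def)
  qed
  have "h (parent_of (k, w) v) < h v" if "v \<in> insert Center (rim_pos N ` inner)" for v
  proof (cases "v = Center")
    case True
    have "H k \<le> b r"
      using I(1,2,3) k by (cases "w k") (auto simp: H_def off_def)
    moreover have "h (rim_pos N k) = H k" using h_rim k by simp
    ultimately show ?thesis using True by (simp add: parent_of_Center) (simp add: h_def)
  next
    case False
    then obtain t where t: "t \<in> inner" "v = rim_pos N t" using \<open>v \<in> _\<close> by auto
    note b = inner_window[OF t(1)]
    have *: "h (rim_pos N (t - 1)) = H (t - 1)" "h (rim_pos N (Suc t)) = H (Suc t)" "h (rim_pos N t) = H t"
      using b by (auto intro!: h_rim)
    have "h Center < H t" if "w t = Hub"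
      using notroot[OF t(1)] that by (simp add: H_def h_def)
    with Hdown[OF t(1)] Hup[OF t(1)] * show ?thesis
      unfolding t(2) parent_of_rim_pos[OF t(1)] by (cases "w t") auto
  qed
  then show ?thesis by blast
qed

lemma parent_of_in_parent_functions:
  assumes "c \<in> configurations"
  shows "parent_of c \<in> parent_functions (wheel N) roots"
proof -
  obtain k w where c: "c = (k, w)" by (cases c)
  have edge: "{v, parent_of c v} \<in> edges (wheel N)" if v: "v \<in> insert Center (rim_pos N ` inner)" for v
  proof (cases "v = Center")
    case True
    then show ?thesis by (simp add: c parent_of_Center wheel_spoke N_pos)
  next
    case False
    then obtain t where t: "t \<in> inner" "v = rim_pos N t" using v by auto
    have "{rim_pos N (t - 1), rim_pos N t} \<in> edges (wheel N)"
      using wheel_rim_edge[OF N_pos, of "t - 1"] inner_window[OF t(1)] by simp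
    with wheel_rim_edge[OF N_pos, of t] wheel_spoke[OF N_pos, of t] show ?thesis
      unfolding t(2) c parent_of_rim_pos[OF t(1)] by (cases "w t") (auto simp: insert_commute)
  qed
  have "parent_of c v \<in> vertices (wheel N)" if v: "v \<in> insert Center (rim_pos N ` inner)" for v
    using edge[OF v] simple_graph_wheel[OF N3] by (auto simp: simple_graph_def)
  then have "parent_of c \<in> insert Center (rim_pos N ` inner) \<rightarrow>\<^sub>E vertices (wheel N)"
    by (intro PiE_I) (auto simp: parent_of_def)
  with edge parent_of_height[of k w] assms show ?thesis
    unfolding parent_functions_def nonroots c by blast
qed

text \<open>The height forces both conditions on a configuration: neighbours pointing at each other
  would each have to be lower than the other, and the path from the hub's parent may not return to
  the hub.\<close>

lemma parent_function_is_parent_of: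
  assumes p: "p \<in> parent_functions (wheel N) roots"
  shows "p \<in> parent_of ` configurations"
proof -
  let ?X = "insert Center (rim_pos N ` inner)"
  obtain h :: "wheel_vertex \<Rightarrow> nat" where h: "\<And>v. v \<in> ?X \<Longrightarrow> h (p v) < h v"
    using p unfolding parent_functions_def nonroots by blast
  have edge: "\<And>v. v \<in> ?X \<Longrightarrow> {v, p v} \<in> edges (wheel N)" and ext: "p \<in> extensional ?X"
    using p unfolding parent_functions_def nonroots by (auto simp: PiE_def)
  have "p Center \<in> rim N" using edge[of Center] wheel_center_neighbours by simp
  then obtain k where k: "k \<in> {b 0..<b r}" "p Center = rim_pos N k"
    unfolding rim_eq_image_rim_pos[of N "b 0"] period by auto
  have "\<exists>x. p (rim_pos N t) = target x t" if t: "t \<in> inner" for t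
  proof -
    have "p (rim_pos N t) = Center \<or> p (rim_pos N t) = rim_pos N (t - 1) \<or> p (rim_pos N t) = rim_pos N (Suc t)"
      using edge[of "rim_pos N t"] t inner_window[OF t] N_pos by (intro wheel_neighbours) auto
    then show ?thesis by (metis target.simps)
  qed
  then obtain w0 where w0: "\<And>t. t \<in> inner \<Longrightarrow> p (rim_pos N t) = target (w0 t) t" by metis
  define w where "w = restrict w0 inner"
  have w: "p (rim_pos N t) = target (w t) t" if "t \<in> inner" for t
    using w0 that by (simp add: w_def)
  have hd: "h (target (w t) t) < h (rim_pos N t)" if "t \<in> inner" for t
    using h[of "rim_pos N t"] w[OF that] that by simp
  have noUD: "\<not> (w t = Up \<and> w (Suc t) = Down)" if t: "t \<in> inner" "Suc t \<in> inner" for t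
    using hd[OF t(1)] hd[OF t(2)] by auto
  then have words: "w \<in> words inner" by (auto simp: words_def w_def)
  have hk: "h (rim_pos N k) < h Center" using h[of Center] k by simp
  have "chain b r k w"
    using k(1)
  proof (cases rule: arc_cases)
    case (1 i)
    then show ?thesis by (auto simp: chain_def)
  next
    case (2 i)
    have inn: "t \<in> inner" if "b i < t" "t < b (Suc i)" for t using that 2 by (auto simp: inner_def)
    \<comment> \<open>A vertex below the hub in height cannot have the hub as parent.\<close>
    have notHub: "w t \<noteq> Hub" if "t \<in> inner" "h (rim_pos N t) < h Center" for t
      using hd[OF that(1)] that(2) by auto
    consider "w k = Down" | "w k = Up"
      using notHub[OF inn[OF 2(2,3)] hk] by (cases "w k") auto
    then show ?thesis
    proof cases
      case 1
      \<comment> \<open>The induction walks down from \<open>k\<close>: each vertex met is still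
        lower than the hub, so it does not point there, and turning \<open>Up\<close> would create a
        forbidden factor.\<close>
      have "w t = Down \<and> h (rim_pos N t) < h Center" if "t \<le> k" "b i < t" for t
        using that
      proof (induction rule: inc_induct)
        case base
        then show ?case using 1 hk by simp
      next
        case (step t)
        have t: "t \<in> inner" "Suc t \<in> inner" using step 2 by (auto intro!: inn)
        have "w (Suc t) = Down" "h (rim_pos N (Suc t)) < h Center" using step by auto
        with hd[OF t(2)] have "h (rim_pos N t) < h Center" by simp
        with notHub[OF t(1)] noUD[OF t] \<open>w (Suc t) = Down\<close> show ?case by (cases "w t") auto
      qed
      with 2 show ?thesis unfolding chain_def by (intro exI[of _ i]) auto
    next
      case up: 2
      have "w t = Up \<and> h (rim_pos N t) < h Center" if "k \<le> t" "t < b (Suc i)" for t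
        using that
      proof (induction rule: dec_induct)
        case base
        then show ?case using up hk by simp
      next
        case (step t)
        have t: "t \<in> inner" "Suc t \<in> inner" using step 2 by (auto intro!: inn)
        have "w t = Up" "h (rim_pos N t) < h Center" using step by auto
        with hd[OF t(1)] have "h (rim_pos N (Suc t)) < h Center" by simp
        with notHub[OF t(2)] noUD[OF t] \<open>w t = Up\<close> show ?case by (cases "w (Suc t)") auto
      qed
      with 2 show ?thesis unfolding chain_def by (intro exI[of _ i]) auto
    qed
  qed
  with words k have "(k, w) \<in> configurations" by (auto simp: configurations_def)
  moreover have "p = parent_of (k, w)"
  proof (rule extensionalityI[OF ext])
    show "parent_of (k, w) \<in> extensional ?X" by (simp add: parent_of_def)
    show "p v = parent_of (k, w) v" if "v \<in> ?X" for v
      using that k w by (auto simp: parent_of_Center parent_of_rim_pos)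
  qed
  ultimately show ?thesis by blast
qed

theorem num_rooted_forests_wheel:
  "real (num_rooted_forests (wheel N) roots) =
     forest_weight (image_mset (\<lambda>i. b (Suc i) - b i) (mset_set {..<r}))"
proof -
  have "parent_functions (wheel N) roots = parent_of ` configurations"
    using parent_of_in_parent_functions parent_function_is_parent_of by blast
  then show ?thesis
    by (simp add: num_rooted_forests_eq_card_parent_functions[OF simple_graph_wheel[OF N3]]
        card_image inj_on_parent_of card_configurations_eq_forest_weight)
qed

end

section \<open>Cyclic intervals\<close>

lemma (in cut_points) sum_arc_lengths: "(\<Sum>i<r. b (Suc i) - b i) = b r - b 0"
proof -
  have "n \<le> r \<Longrightarrow> (\<Sum>i<n. b (Suc i) - b i) = b n - b 0" for n
  proof (induction n)
    case (Suc n)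
    then show ?case using b_mono[of 0 n] less_Suc[of n] by simp
  qed simp
  then show ?thesis by simp
qed

context
  fixes N r :: nat and R :: "wheel_vertex set"
  assumes N3: "N \<ge> 3" and r_pos: "r \<ge> 1" and R: "R \<in> rim_root_sets N r"
begin

lemma cyclic_intervals_cut_points:
  obtains b where "rim_roots b r N" "R = rim_pos N ` b ` {..<r}"
    "cyclic_intervals N R = map (\<lambda>i. b (Suc i) - b i) [0..<r]"
proof -
  define A where "A = {i. Rim i \<in> R}"
  define a where "a = sorted_list_of_set A"
  have RA: "R = Rim ` A" and A: "A \<subseteq> {1..N}"
    using R by (auto simp: rim_root_sets_def rim_def A_def)
  have fin: "finite A" using A finite_subset by blast
  have "card A = r"
    using R card_image[of Rim A] unfolding RA rim_root_sets_def by (simp add: inj_on_def)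
  then have len: "length a = r" by (simp add: a_def)
  have set_a: "set a = A" using fin by (simp add: a_def)
  have a_bounds: "1 \<le> a ! i \<and> a ! i \<le> N" if "i < r" for i
    using that A set_a len nth_mem[of i a] by auto
  have a_less: "a ! i < a ! Suc i" if "Suc i < r" for i
    using that len sorted_wrt_nth_less[of "(<)" a i "Suc i"] strict_sorted_list_of_set[of A]
    by (simp add: a_def)
  \<comment> \<open>The shift by one matches \<open>rim_pos\<close>. The extra value at
    \<open>r\<close> is the first root one turn later, so the wrap-around interval becomes an
    ordinary difference.\<close>
  define b where "b i = (if i < r then a ! i - 1 else a ! 0 - 1 + N)" for i
  have b_less: "b i < b (Suc i)" if "i < r" for i
    using that a_less[of i] a_bounds[of i] a_bounds[of 0] a_bounds[of "Suc i"] by (auto simp: b_def)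
  have "rim_roots b r N"
    using N3 r_pos b_less by unfold_locales (auto simp: b_def)
  moreover have "R = rim_pos N ` b ` {..<r}"
  proof -
    have "rim_pos N (b i) = Rim (a ! i)" if "i < r" for i
    proof -
      have "a ! i - 1 < N" using a_bounds[OF that] by linarith
      then show ?thesis using that a_bounds[OF that] by (simp add: rim_pos_def b_def)
    qed
    then have "rim_pos N ` b ` {..<r} = Rim ` (!) a ` {..<r}" by (simp add: image_image)
    also have "(!) a ` {..<r} = A" using set_a len by (auto simp: set_conv_nth)
    finally show ?thesis using RA by simp
  qed
  moreover have "cyclic_intervals N R = map (\<lambda>i. b (Suc i) - b i) [0..<r]"
  proof -
    have "(if Suc i < r then a ! Suc i - a ! i else a ! 0 + N - a ! i) = b (Suc i) - b i" if "i < r" for i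
      using that a_bounds[of i] a_bounds[of 0] a_bounds[of "Suc i"] by (auto simp: b_def)
    then show ?thesis
      unfolding cyclic_intervals_def A_def[symmetric] a_def[symmetric] Let_def len by simp
  qed
  ultimately show ?thesis by (rule that)
qed

lemma length_cyclic_intervals: "length (cyclic_intervals N R) = r"
  by (rule cyclic_intervals_cut_points) simp

lemma cyclic_intervals_positive_partition: "mset (cyclic_intervals N R) \<in> positive_partitions N r"
proof (rule cyclic_intervals_cut_points)
  fix b
  assume b: "rim_roots b r N" and eq: "cyclic_intervals N R = map (\<lambda>i. b (Suc i) - b i) [0..<r]"
  interpret rim_roots b r N by (rule b)
  have "sum_list (cyclic_intervals N R) = N"
    using sum_arc_lengths period by (simp add: eq sum_list_sum_nth atLeast0LessThan)
  moreover have "0 \<notin> set (cyclic_intervals N R)"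
  proof
    assume "0 \<in> set (cyclic_intervals N R)"
    then obtain i where "i < r" "b (Suc i) - b i = 0" by (auto simp: eq)
    with less_Suc[of i] show False by simp
  qed
  moreover have "length (cyclic_intervals N R) = r" by (simp add: eq)
  ultimately show ?thesis
    by (simp add: positive_partitions_def sum_mset_sum_list)
qed

lemma num_rooted_forests_eq_forest_weight:
  "real (num_rooted_forests (wheel N) R) = forest_weight (mset (cyclic_intervals N R))"
proof (rule cyclic_intervals_cut_points)
  fix b
  assume b: "rim_roots b r N" and R: "R = rim_pos N ` b ` {..<r}"
    and eq: "cyclic_intervals N R = map (\<lambda>i. b (Suc i) - b i) [0..<r]"
  interpret rim_roots b r N by (rule b)
  show ?thesis
    unfolding eq using num_rooted_forests_wheel unfolding R by (simp add: atLeast0LessThan)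
qed

end

text \<open>Roots are placed at one plus the partial sums of an enumeration of \<open>M\<close>; the
  total \<open>N\<close> makes the wrap-around interval the last part. Thus optimizing over root
  sets is optimizing over partitions.\<close>

lemma positive_partition_realizable:
  assumes M: "M \<in> positive_partitions N r" and r: "r \<ge> 1"
  shows "\<exists>R\<in>rim_root_sets N r. mset (cyclic_intervals N R) = M"
proof -
  obtain ds where ds: "mset ds = M" by (metis ex_mset)
  have len: "length ds = r" and nz: "0 \<notin> set ds" and sum: "sum_list ds = N"
    using M unfolding ds[symmetric] by (simp_all add: positive_partitions_def sum_mset_sum_list)
  have pos: "ds ! i > 0" if "i < r" for i
    using that nz len by (metis gr0I nth_mem)
  define p where "p i = sum_list (take i ds)" for i
  have p_Suc: "p (Suc i) = p i + ds ! i" if "i < r" for i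
    using that len by (simp add: p_def take_Suc_conv_app_nth)
  interpret cut_points p r
    using p_Suc pos by unfold_locales simp
  have p_less: "p i < p j" if "i < j" "j \<le> r" for i j
    using that less_Suc[of i] b_mono[of "Suc i" j] by simp
  have p0: "p 0 = 0" and pr: "p r = N" using len sum by (auto simp: p_def)
  define a where "a = map (\<lambda>i. Suc (p i)) [0..<r]"
  define R where "R = Rim ` set a"
  have "sorted_wrt (<) a"
    unfolding a_def by (auto simp: sorted_wrt_iff_nth_less p_less)
  then have sla: "sorted_list_of_set (set a) = a" and "distinct a"
    by (simp_all add: strict_sorted_iff sorted_list_of_set.idem_if_sorted_distinct)
  have "R \<subseteq> rim N"
    using p_less[of _ r] pr by (auto simp: R_def rim_def a_def Suc_le_eq)
  moreover have "card R = r"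
    using distinct_card[OF \<open>distinct a\<close>] by (simp add: R_def card_image inj_on_def a_def)
  moreover have "cyclic_intervals N R = ds"
  proof (rule nth_equalityI)
    have Ra: "{i. Rim i \<in> R} = set a" by (auto simp: R_def)
    have eq: "cyclic_intervals N R =
      map (\<lambda>i. if Suc i < r then a ! Suc i - a ! i else a ! 0 + N - a ! i) [0..<r]"
      unfolding cyclic_intervals_def Ra sla Let_def by (simp add: a_def)
    then show "length (cyclic_intervals N R) = length ds" using len by simp
    fix i assume "i < length (cyclic_intervals N R)"
    then have i: "i < r" by (simp add: eq)
    show "cyclic_intervals N R ! i = ds ! i"
    proof (cases "Suc i < r")
      case True
      then show ?thesis using i p_Suc[OF i] by (simp add: eq a_def)
    next
      case False
      then have "Suc i = r" using i by simp
      have "cyclic_intervals N R ! i = a ! 0 + N - a ! i" using i False by (simp add: eq)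
      also have "\<dots> = ds ! i" using i p_Suc[OF i] p0 pr \<open>Suc i = r\<close> by (simp add: a_def)
      finally show ?thesis .
    qed
  qed
  ultimately show ?thesis using ds by (auto simp: rim_root_sets_def)
qed

section \<open>The extremal root sets\<close>

text \<open>The two counts exhaust the length of the list, leaving no room for a third
  value.\<close>

lemma count_list_eq_replicate_iff:
  assumes "length xs = m + n" "x \<noteq> y"
  shows "count_list xs x = m \<and> count_list xs y = n \<longleftrightarrow> mset xs = replicate_mset m x + replicate_mset n y"
proof
  assume "count_list xs x = m \<and> count_list xs y = n"
  then have sub: "replicate_mset m x + replicate_mset n y \<subseteq># mset xs"
    using assms(2) by (intro mset_subset_eqI) (auto simp: count_mset)
  show "mset xs = replicate_mset m x + replicate_mset n y"
  proof (rule ccontr)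
    assume "mset xs \<noteq> replicate_mset m x + replicate_mset n y"
    with sub have "replicate_mset m x + replicate_mset n y \<subset># mset xs" by auto
    from mset_subset_size[OF this] assms(1) show False by simp
  qed
next
  assume "mset xs = replicate_mset m x + replicate_mset n y"
  then show "count_list xs x = m \<and> count_list xs y = n"
    using assms(2) by (simp flip: count_mset)
qed

lemma all_but_one_equal_iff:
  "(\<exists>i<length xs. xs ! i = m \<and> (\<forall>j<length xs. j \<noteq> i \<longrightarrow> xs ! j = c)) \<longleftrightarrow>
     mset xs = add_mset m (replicate_mset (length xs - 1) c)"
proof -
  \<comment> \<open>\<open>rest i\<close> is the list with its entry at position \<open>i\<close>
    deleted.\<close>
  define rest where "rest i = take i xs @ drop (Suc i) xs" for i
  have split: "mset xs = add_mset (xs ! i) (mset (rest i))" if "i < length xs" for i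
    using arg_cong[OF id_take_nth_drop[OF that], of mset] by (simp add: rest_def)
  have set_rest: "set (rest i) = {xs ! j |j. j < length xs \<and> j \<noteq> i}" if i: "i < length xs" for i
  proof (intro equalityI subsetI)
    fix x assume "x \<in> set (rest i)"
    then consider j where "j < i" "x = xs ! j" | j where "j < length xs - Suc i" "x = xs ! (Suc i + j)"
      using i by (auto simp: rest_def in_set_conv_nth)
    then show "x \<in> {xs ! j |j. j < length xs \<and> j \<noteq> i}"
    proof cases
      case (1 j)
      then show ?thesis using i by (intro CollectI exI[of _ j]) simp
    next
      case (2 j)
      then show ?thesis by (intro CollectI exI[of _ "Suc i + j"]) simp
    qed
  next
    fix x assume "x \<in> {xs ! j |j. j < length xs \<and> j \<noteq> i}"
    then obtain j where j: "x = xs ! j" "j < length xs" "j \<noteq> i" by blast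
    show "x \<in> set (rest i)"
    proof (cases "j < i")
      case True
      then have "x = take i xs ! j" "j < length (take i xs)" using j by simp_all
      then show ?thesis unfolding rest_def by (metis nth_mem UnCI set_append)
    next
      case False
      then have "x = drop (Suc i) xs ! (j - Suc i)" "j - Suc i < length (drop (Suc i) xs)"
        using j by simp_all
      then show ?thesis unfolding rest_def by (metis nth_mem UnCI set_append)
    qed
  qed
  show ?thesis
  proof
    assume "\<exists>i<length xs. xs ! i = m \<and> (\<forall>j<length xs. j \<noteq> i \<longrightarrow> xs ! j = c)"
    then obtain i where i: "i < length xs" "xs ! i = m" "\<forall>j<length xs. j \<noteq> i \<longrightarrow> xs ! j = c" by blast
    have "mset (rest i) = replicate_mset (size (mset (rest i))) c"
      using set_rest[OF i(1)] i(3) by (intro set_mset_subset_singletonD) auto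
    moreover have "size (mset (rest i)) = length xs - 1" using i(1) by (simp add: rest_def)
    ultimately show "mset xs = add_mset m (replicate_mset (length xs - 1) c)"
      using split[OF i(1)] i(2) by simp
  next
    assume eq: "mset xs = add_mset m (replicate_mset (length xs - 1) c)"
    then have "m \<in># mset xs" by simp
    then obtain i where i: "i < length xs" "xs ! i = m" by (auto simp: in_set_conv_nth)
    then have "mset (rest i) = replicate_mset (length xs - 1) c" using split[OF i(1)] eq by simp
    then have "set (rest i) \<subseteq> {c}"
      by (metis set_mset_mset set_mset_replicate_mset_subset subset_singleton_iff order_refl)
    then show "\<exists>i<length xs. xs ! i = m \<and> (\<forall>j<length xs. j \<noteq> i \<longrightarrow> xs ! j = c)"
      using i set_rest[OF i(1)] by blast
  qed
qed

section \<open>Maximizers and minimizers among root sets\<close>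

lemma finite_rim_root_sets: "finite (rim_root_sets N r)"
  by (rule finite_subset[of _ "Pow (rim N)"]) (auto simp: rim_root_sets_def rim_def)

lemma rim_root_sets_nonempty:
  assumes "r \<le> N"
  shows "rim_root_sets N r \<noteq> {}"
proof -
  have "card (rim N) = N" by (simp add: rim_def card_image inj_on_def)
  with assms obtain R where "R \<subseteq> rim N" "card R = r"
    by (metis obtain_subset_with_card_n)
  then show ?thesis by (auto simp: rim_root_sets_def)
qed

lemma is_arg_max_iff_Max:
  fixes f :: "'a \<Rightarrow> nat"
  assumes "finite S"
  shows "is_arg_max f (\<lambda>x. x \<in> S) x \<longleftrightarrow> x \<in> S \<and> f x = Max (f ` S)"
proof -
  have "f x = Max (f ` S) \<longleftrightarrow> (\<forall>y\<in>S. f y \<le> f x)" if "x \<in> S"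
    using assms that by (subst eq_commute, subst Max_eq_iff) auto
  then show ?thesis by (auto simp: is_arg_max_def not_less)
qed

lemma is_arg_min_iff_Min:
  fixes f :: "'a \<Rightarrow> nat"
  assumes "finite S"
  shows "is_arg_min f (\<lambda>x. x \<in> S) x \<longleftrightarrow> x \<in> S \<and> f x = Min (f ` S)"
proof -
  have "f x = Min (f ` S) \<longleftrightarrow> (\<forall>y\<in>S. f x \<le> f y)" if "x \<in> S"
    using assms that by (subst eq_commute, subst Min_eq_iff) auto
  then show ?thesis by (auto simp: is_arg_min_def not_less)
qed

theorem theorem5p2:
  fixes N r q s :: nat
  assumes "N \<ge> 3" and "1 \<le> r" and "r \<le> N" and "N = q * r + s" and "s < r"
  shows
    "(\<forall>R \<in> rim_root_sets N r.
        is_arg_max (num_rooted_forests (wheel N)) (\<lambda>R'. R' \<in> rim_root_sets N r) R \<longleftrightarrow>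
          count_list (cyclic_intervals N R) (q + 1) = s \<and>
          count_list (cyclic_intervals N R) q = r - s)
     \<and> real (Max (num_rooted_forests (wheel N) ` rim_root_sets N r)) =
         real (fib (2 * (q + 1))) ^ s * real (fib (2 * q)) ^ (r - s) *
         (real s * ((real (lucas (2 * (q + 1))) - 2) / real (fib (2 * (q + 1)))) +
          real (r - s) * ((real (lucas (2 * q)) - 2) / real (fib (2 * q))))
     \<and> (\<forall>R \<in> rim_root_sets N r.
        is_arg_min (num_rooted_forests (wheel N)) (\<lambda>R'. R' \<in> rim_root_sets N r) R \<longleftrightarrow>
          (\<exists>i<r. cyclic_intervals N R ! i = N - r + 1 \<and>
             (\<forall>j<r. j \<noteq> i \<longrightarrow> cyclic_intervals N R ! j = 1)))
     \<and> real (Min (num_rooted_forests (wheel N) ` rim_root_sets N r)) =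
         real (lucas (2 * (N - r + 1))) - 2 +
         real (r - 1) * real (fib (2 * (N - r + 1)))"
proof -
  let ?S = "rim_root_sets N r" and ?f = "num_rooted_forests (wheel N)"
  let ?M = "\<lambda>R. mset (cyclic_intervals N R)"
  define balanced where "balanced = replicate_mset s (q + 1) + replicate_mset (r - s) q"
  define unbalanced where "unbalanced = add_mset (N - r + 1) (replicate_mset (r - 1) 1)"
  note weight = num_rooted_forests_eq_forest_weight[OF assms(1,2)]
    and len = length_cyclic_intervals[OF assms(1,2)]
    and part = cyclic_intervals_positive_partition[OF assms(1,2)]
  have fin: "finite ?S" "finite (?f ` ?S)" and ne: "?f ` ?S \<noteq> {}"
    using finite_rim_root_sets rim_root_sets_nonempty[OF assms(3)] by auto
  have max: "?M R = balanced" if R: "R \<in> ?S" "?f R = Max (?f ` ?S)" for R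
    unfolding balanced_def
  proof (rule forest_weight_max_balanced[OF part[OF R(1)] _ assms(4,5)])
    fix M assume "M \<in> positive_partitions N r"
    then obtain R' where R': "R' \<in> ?S" "?M R' = M"
      using positive_partition_realizable[OF _ assms(2)] by blast
    have "?f R' \<le> ?f R" using R'(1) R(2) fin by simp
    then show "forest_weight M \<le> forest_weight (?M R)"
      using weight[OF R(1)] weight[OF R'(1)] R'(2) by (metis of_nat_le_iff)
  qed
  have min: "?M R = unbalanced" if R: "R \<in> ?S" "?f R = Min (?f ` ?S)" for R
    unfolding unbalanced_def
  proof (rule forest_weight_min_unbalanced[OF part[OF R(1)] assms(2)])
    fix M assume "M \<in> positive_partitions N r"
    then obtain R' where R': "R' \<in> ?S" "?M R' = M"
      using positive_partition_realizable[OF _ assms(2)] by blast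
    have "?f R \<le> ?f R'" using R'(1) R(2) fin by simp
    then show "forest_weight (?M R) \<le> forest_weight M"
      using weight[OF R(1)] weight[OF R'(1)] R'(2) by (metis of_nat_le_iff)
  qed
  \<comment> \<open>The maximum is attained, and any root set attaining it has balanced intervals,
    which determines the value.\<close>
  have Max: "real (Max (?f ` ?S)) = forest_weight balanced"
    using Max_in[OF fin(2) ne] max weight by (metis imageE)
  have Min: "real (Min (?f ` ?S)) = forest_weight unbalanced"
    using Min_in[OF fin(2) ne] min weight by (metis imageE)
  have arg_max: "is_arg_max ?f (\<lambda>R'. R' \<in> ?S) R \<longleftrightarrow>
      count_list (cyclic_intervals N R) (q + 1) = s \<and> count_list (cyclic_intervals N R) q = r - s"
    if R: "R \<in> ?S" for R
  proof -
    \<comment> \<open>Conversely, balanced intervals give the weight just identified as the maximum,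
      so such a root set is a maximizer.\<close>
    have "is_arg_max ?f (\<lambda>R'. R' \<in> ?S) R \<longleftrightarrow> ?M R = balanced"
      using is_arg_max_iff_Max[OF fin(1)] max[OF R] R weight[OF R] Max by (metis of_nat_eq_iff)
    also have "\<dots> \<longleftrightarrow> count_list (cyclic_intervals N R) (q + 1) = s \<and> count_list (cyclic_intervals N R) q = r - s"
      unfolding balanced_def using len[OF R] assms(5) by (intro count_list_eq_replicate_iff[symmetric]) auto
    finally show ?thesis .
  qed
  have arg_min: "is_arg_min ?f (\<lambda>R'. R' \<in> ?S) R \<longleftrightarrow>
      (\<exists>i<r. cyclic_intervals N R ! i = N - r + 1 \<and>
             (\<forall>j<r. j \<noteq> i \<longrightarrow> cyclic_intervals N R ! j = 1))"
    if R: "R \<in> ?S" for R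
  proof -
    have "is_arg_min ?f (\<lambda>R'. R' \<in> ?S) R \<longleftrightarrow> ?M R = unbalanced"
      using is_arg_min_iff_Min[OF fin(1)] min[OF R] R weight[OF R] Min by (metis of_nat_eq_iff)
    also have "\<dots> \<longleftrightarrow> (\<exists>i<r. cyclic_intervals N R ! i = N - r + 1 \<and>
             (\<forall>j<r. j \<noteq> i \<longrightarrow> cyclic_intervals N R ! j = 1))"
      unfolding unbalanced_def using all_but_one_equal_iff[of "cyclic_intervals N R"] len[OF R] by simp
    finally show ?thesis .
  qed
  have "forest_weight unbalanced =
      real (lucas (2 * (N - r + 1))) - 2 + real (r - 1) * real (fib (2 * (N - r + 1)))"
    unfolding unbalanced_def by (rule forest_weight_unbalanced) simp
  from Min[unfolded this] Max[unfolded balanced_def forest_weight_balanced] show ?thesis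
    by (intro conjI ballI arg_max arg_min)
qed

end
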